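(* Let $\mathbb{F}\in\{\mathbb{R},\mathbb{C}\}$ and $A\in\mathbb{F}^{m\times n\times p}$ with multilinear rank $(r_1,r_2,r_3)$. Then \[ \max\Bigl\{\tfrac{\|\flat_1(A)\|_\sigma}{\sqrt{\min(r_2,r_3)}},\tfrac{\|\flat_2(A)\|_\sigma}{\sqrt{\min(r_1,r_3)}},\tfrac{\|\flat_3(A)\|_\sigma}{\sqrt{\min(r_1,r_2)}}\Bigr\}\le\|A\|_\sigma\le\min\{\|\flat_1(A)\|_\sigma,\|\flat_2(A)\|_\sigma,\|\flat_3(A)\|_\sigma\} \] and \[ \max\{\|\flat_1(A)\|_*,\|\flat_2(A)\|_*,\|\flat_3(A)\|_*\}\le\|A\|_*\le\min\bigl\{\sqrt{\min(r_2,r_3)}\|\flat_1(A)\|_*,\sqrt{\min(r_1,r_3)}\|\flat_2(A)\|_*,\sqrt{\min(r_1,r_2)}\|\flat_3(A)\|_*\bigr\}. \]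
   Context: $\flat_1(A)\in\mathbb{F}^{m\times np}$ is the matrix whose $i$-th row lists the entries $a_{ijk}$ ($j,k$ varying); similarly $\flat_2(A)\in\mathbb{F}^{n\times mp}$ has $j$-th row listing $a_{ijk}$ ($i,k$ varying) and $\flat_3(A)\in\mathbb{F}^{p\times mn}$ has $k$-th row listing $a_{ijk}$ ($i,j$ varying) (column order fixed, irrelevant for the norms below). The multilinear rank is $(r_1,r_2,r_3)=(\operatorname{rank}\flat_1(A),\operatorname{rank}\flat_2(A),\operatorname{rank}\flat_3(A))$. For matrices, $\|\cdot\|_\sigma$ is the largest singular value and $\|\cdot\|_*$ the sum of singular values. For the tensor $A$ (over $\mathbb{F}$): $\|A\|_\sigma=\sup\{|\langle A,x\otimes y\otimes z\rangle|/(\|x\|\|y\|\|z\|):0\ne x\in\mathbb{F}^m,y\in\mathbb{F}^n,z\in\mathbb{F}^p\}$ with $\langle A,B\rangle=\sum a_{ijk}\overline{b_{ijk}}$, and $\|A\|_*=\inf\{\sum_i\|x_i\|\|y_i\|\|z_i\|:A=\sum_i x_i\otimes y_i\otimes z_i\}$, Euclidean norms. *)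

theory Defs
  imports "HOL-Analysis.Analysis"
begin

text \<open>
  The ground field \<open>\<real>\<close> or \<open>\<complex>\<close>, with its absolute value and conjugation. The last axiom says that the
  field is \<open>\<real>\<close> or \<open>\<real>(i)\<close>; \<open>mult_conjugate\<close> then leaves no freedom in \<open>conjugate\<close>, the norm and the
  real inner product inherited from \<^class>\<open>euclidean_space\<close>.
\<close>

class real_or_complex = real_normed_field + euclidean_space +
  fixes conjugate :: "'a \<Rightarrow> 'a"
  assumes conjugate_add: "conjugate (x + y) = conjugate x + conjugate y"
    and conjugate_mult: "conjugate (x * y) = conjugate x * conjugate y"
    and mult_conjugate: "x * conjugate x = (norm x)\<^sup>2 *\<^sub>R 1"
    and real_or_complex:
      "(\<forall>x. \<exists>a. x = a *\<^sub>R 1) \<or>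
       (\<exists>i. i * i = - 1 \<and> (\<forall>x. \<exists>a b. x = a *\<^sub>R 1 + b *\<^sub>R i))"

instantiation real :: real_or_complex
begin

definition conjugate_real :: "real \<Rightarrow> real" where
  "conjugate_real x = x"

instance
  by standard (auto simp: conjugate_real_def power2_eq_square)

end

instantiation complex :: real_or_complex
begin

definition conjugate_complex :: "complex \<Rightarrow> complex" where
  "conjugate_complex x = cnj x"

instance
proof
  fix x y :: complex
  show "conjugate (x + y) = conjugate x + conjugate y"
    by (simp add: conjugate_complex_def)
  show "conjugate (x * y) = conjugate x * conjugate y"
    by (simp add: conjugate_complex_def)
  show "x * conjugate x = (norm x)\<^sup>2 *\<^sub>R 1"
    by (simp add: conjugate_complex_def complex_norm_square[symmetric] scaleR_conv_of_real del: of_real_power)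
  show "(\<forall>x::complex. \<exists>a. x = a *\<^sub>R 1) \<or>
    (\<exists>i::complex. i * i = - 1 \<and> (\<forall>x. \<exists>a b. x = a *\<^sub>R 1 + b *\<^sub>R i))"
    by (intro disjI2 exI[of _ \<i>] conjI allI)
      (simp_all add: complex_eq_iff)
qed

end

text \<open>
  The norm on \<^typ>\<open>'a^'n\<close> is the Euclidean one. A matrix with \<open>m\<close> rows and \<open>n\<close> columns has
  type \<^typ>\<open>'a^'n^'m\<close>, a tensor of format \<open>m \<times> n \<times> p\<close> has type \<^typ>\<open>'a^'p^'n^'m\<close>.
\<close>

definition conj_transpose :: "'a::real_or_complex^'n^'m \<Rightarrow> 'a^'m^'n" where
  "conj_transpose M = (\<chi> j i. conjugate (M $ i $ j))"

definition singular_space :: "'a::real_or_complex^'n^'m \<Rightarrow> real \<Rightarrow> ('a^'n) set" where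
  "singular_space M s = {v. (conj_transpose M ** M) *v v = of_real (s\<^sup>2) *s v}"

text \<open>
  The singular values are the square roots of the eigenvalues of \<open>M\<^sup>*M\<close>. As \<open>M\<^sup>*M\<close> is Hermitian, the
  multiplicity of an eigenvalue is the dimension over the ground field of its eigenspace.
  Using \<open>M\<^sup>*M\<close> also for wide matrices only adds zeros to the list of singular values.
\<close>

definition singular_values :: "'a::real_or_complex^'n^'m \<Rightarrow> real set" where
  "singular_values M = {s. 0 \<le> s \<and> (\<exists>v\<in>singular_space M s. v \<noteq> 0)}"

definition matrix_spectral_norm :: "'a::real_or_complex^'n^'m \<Rightarrow> real" where
  "matrix_spectral_norm M = Max (singular_values M)"

definition matrix_nuclear_norm :: "'a::real_or_complex^'n^'m \<Rightarrow> real" where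
  "matrix_nuclear_norm M = (\<Sum>s\<in>singular_values M. real (vec.dim (singular_space M s)) * s)"

definition flat1 :: "'a^'p^'n^'m \<Rightarrow> 'a^('n \<times> 'p)^'m" where
  "flat1 A = (\<chi> i jk. A $ i $ fst jk $ snd jk)"

definition flat2 :: "'a^'p^'n^'m \<Rightarrow> 'a^('m \<times> 'p)^'n" where
  "flat2 A = (\<chi> j ik. A $ fst ik $ j $ snd ik)"

definition flat3 :: "'a^'p^'n^'m \<Rightarrow> 'a^('m \<times> 'n)^'p" where
  "flat3 A = (\<chi> k ij. A $ fst ij $ snd ij $ k)"

definition multilinear_rank :: "'a::field^'p^'n^'m \<Rightarrow> nat \<times> nat \<times> nat" where
  "multilinear_rank A = (rank (flat1 A), rank (flat2 A), rank (flat3 A))"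

definition outer3 :: "'a::times^'m \<Rightarrow> 'a^'n \<Rightarrow> 'a^'p \<Rightarrow> 'a^'p^'n^'m" where
  "outer3 x y z = (\<chi> i j k. x $ i * y $ j * z $ k)"

definition tensor_inner :: "'a::real_or_complex^'p^'n^'m \<Rightarrow> 'a^'p^'n^'m \<Rightarrow> 'a" where
  "tensor_inner A B =
    (\<Sum>i\<in>UNIV. \<Sum>j\<in>UNIV. \<Sum>k\<in>UNIV. A $ i $ j $ k * conjugate (B $ i $ j $ k))"

definition tensor_spectral_norm :: "'a::real_or_complex^'p^'n^'m \<Rightarrow> real" where
  "tensor_spectral_norm A =
    Sup {norm (tensor_inner A (outer3 x y z)) / (norm x * norm y * norm z) | x y z.
      x \<noteq> 0 \<and> y \<noteq> 0 \<and> z \<noteq> 0}"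

definition tensor_nuclear_norm :: "'a::real_or_complex^'p^'n^'m \<Rightarrow> real" where
  "tensor_nuclear_norm A =
    Inf {\<Sum>i<r. norm (x i) * norm (y i) * norm (z i) | (r::nat) x y z.
      A = (\<Sum>i<r. outer3 (x i) (y i) (z i))}"

end

theory Submission
  imports Defs
begin

text \<open>
  The singular values of \<open>M\<close> are the norms \<open>\<parallel>M v\<^sub>i\<parallel>\<close> for an orthonormal basis \<open>v\<^sub>i\<close> with
  pairwise orthogonal images, which is found by greedily maximising \<open>\<parallel>M x\<parallel>\<close> on the orthogonal
  complement of the vectors chosen so far. By Cauchy--Schwarz, a matrix \<open>B\<close> of rank at most \<open>r\<close>
  is then a sum of dyads \<open>b\<^sub>l c\<^sub>l\<^sup>T\<close> with \<open>\<Sum> \<parallel>b\<^sub>l\<parallel> \<parallel>c\<^sub>l\<parallel> \<le> \<surd>r \<parallel>B\<parallel>\<close>, where \<open>\<parallel>B\<parallel>\<close> is the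
  Frobenius norm.

  Read as an \<open>n \<times> p\<close> matrix, a right singular vector of the first flattening for a nonzero
  singular value is, up to conjugation and scaling, a contraction \<open>(\<Sum>\<^sub>i u\<^sub>i\<^sup>* a\<^sub>i\<^sub>j\<^sub>k)\<^sub>j\<^sub>k\<close> of the tensor,
  hence of rank at most \<open>min r\<^sub>2 r\<^sub>3\<close>. Decomposing it into dyads gives the two bounds with the factor
  \<open>\<surd>(min r\<^sub>2 r\<^sub>3)\<close>. The other two bounds hold because \<open>x \<otimes> y \<otimes> z\<close> flattens to the dyad
  \<open>x (y \<otimes> z)\<^sup>T\<close>. The other flattenings are first flattenings of tensors with permuted modes.
\<close>

section \<open>The Hermitian inner product\<close>

definition hinner :: "'a::real_or_complex^'n \<Rightarrow> 'a^'n \<Rightarrow> 'a" where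
  "hinner x y = (\<Sum>i\<in>UNIV. x $ i * conjugate (y $ i))"

text \<open>Rows of a matrix and dyads \<open>b c^T\<close> pair bilinearly, \<open>hinner\<close>
  sesquilinearly; entrywise conjugation translates between the two.\<close>

definition vconj :: "'a::real_or_complex^'n \<Rightarrow> 'a^'n" where
  "vconj x = (\<chi> i. conjugate (x $ i))"

lemma conjugate_zero [simp]: "conjugate (0::'a::real_or_complex) = 0"
  using conjugate_add[of "0::'a" 0] by simp

lemma norm_conjugate [simp]: "norm (conjugate x) = norm (x::'a::real_or_complex)"
proof (cases "x = 0")
  case False
  have "norm (x * conjugate x) = (norm x)\<^sup>2"
    by (simp add: mult_conjugate)
  then show ?thesis
    using False by (simp add: norm_mult power2_eq_square)
qed simp

lemma mult_conjugate_of_real: "x * conjugate x = of_real ((norm (x::'a::real_or_complex))\<^sup>2)"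
  by (simp only: mult_conjugate of_real_def)

text \<open>Not among the class axioms: \<open>x * conjugate x\<close> and
  \<open>conjugate x * conjugate (conjugate x)\<close> both equal the squared norm of
  \<open>x\<close>, and the nonzero factor \<open>conjugate x\<close> cancels.\<close>

lemma conjugate_conjugate [simp]: "conjugate (conjugate x) = (x::'a::real_or_complex)"
proof (cases "x = 0")
  case False
  have "conjugate x * conjugate (conjugate x) = conjugate x * x"
    using mult_conjugate_of_real[of x] mult_conjugate_of_real[of "conjugate x"]
    by (simp add: mult.commute)
  moreover have "conjugate x \<noteq> 0"
    using False by (metis norm_conjugate norm_eq_zero)
  ultimately show ?thesis by simp
qed simp

lemma conjugate_of_real [simp]: "conjugate (of_real r) = (of_real r :: 'a::real_or_complex)"
proof (cases "r = 0")
  case False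
  have "of_real r * conjugate (of_real r) = (of_real r * of_real r :: 'a)"
    by (simp add: mult_conjugate_of_real power2_eq_square)
  then show ?thesis using False by simp
qed simp

lemma conjugate_eq_0_iff [simp]: "conjugate x = 0 \<longleftrightarrow> x = (0::'a::real_or_complex)"
  by (metis norm_conjugate norm_eq_zero)

lemma conjugate_sum: "conjugate (\<Sum>i\<in>I. f i) = (\<Sum>i\<in>I. conjugate (f i :: 'a::real_or_complex))"
  by (induction I rule: infinite_finite_induct) (simp_all add: conjugate_add)

lemma norm_vec_square: "(norm x)\<^sup>2 = (\<Sum>i\<in>UNIV. (norm (x $ i))\<^sup>2)"
  by (simp add: norm_vec_def L2_set_def sum_nonneg)

lemma scaleR_eq_smult: "r *\<^sub>R x = (of_real r :: 'a::real_normed_field) *s x"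
  unfolding vec_eq_iff vector_scaleR_component by (simp add: scaleR_conv_of_real)

lemma norm_smult [simp]: "norm (c *s x) = norm (c :: 'a::real_or_complex) * norm x"
proof -
  have "(norm (c *s x))\<^sup>2 = (norm c * norm x)\<^sup>2"
    by (simp add: norm_vec_square power_mult_distrib norm_mult sum_distrib_left)
  then show ?thesis by (simp add: power2_eq_iff_nonneg)
qed

lemma mult_vec_scaleR: "M *v (r *\<^sub>R x) = r *\<^sub>R (M *v (x :: 'a::real_normed_field^'n))"
  by (simp add: scaleR_eq_smult vector_scalar_commute)

lemma hinner_self: "hinner x x = of_real ((norm x)\<^sup>2)"
  by (simp add: hinner_def mult_conjugate_of_real norm_vec_square)

lemma hinner_add_left: "hinner (x + y) z = hinner x z + hinner y z"
  by (simp add: hinner_def algebra_simps sum.distrib)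

lemma hinner_add_right: "hinner z (x + y) = hinner z x + hinner z y"
  by (simp add: hinner_def algebra_simps sum.distrib conjugate_add)

lemma hinner_smult_left [simp]: "hinner (c *s x) z = c * hinner x z"
  by (simp add: hinner_def sum_distrib_left mult.assoc)

lemma hinner_smult_right [simp]: "hinner z (c *s x) = conjugate c * hinner z x"
  by (simp add: hinner_def sum_distrib_left mult_ac conjugate_mult)

lemma hinner_zero_left [simp]: "hinner 0 x = 0"
  and hinner_zero_right [simp]: "hinner x 0 = 0"
  by (simp_all add: hinner_def)

lemma hinner_diff_left: "hinner (x - y) z = hinner x z - hinner y z"
  by (simp add: hinner_def algebra_simps sum_subtractf)

lemma hinner_sum_left: "hinner (\<Sum>i\<in>I. f i) z = (\<Sum>i\<in>I. hinner (f i) z)"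
  by (induction I rule: infinite_finite_induct) (simp_all add: hinner_add_left)

lemma hinner_sum_right: "hinner z (\<Sum>i\<in>I. f i) = (\<Sum>i\<in>I. hinner z (f i))"
  by (induction I rule: infinite_finite_induct) (simp_all add: hinner_add_right)

lemma hinner_commute: "hinner y x = conjugate (hinner x y)"
  by (simp add: hinner_def conjugate_sum conjugate_mult mult.commute)

lemma hinner_commute_eq_0: "hinner x y = 0 \<longleftrightarrow> hinner y x = 0"
  by (subst hinner_commute) simp

text \<open>Both forms polarise the same norm: comparing two expansions of the squared norm of
  \<open>x + y\<close> ties the inherited real inner product to \<open>conjugate\<close>. This makes
  \<open>inner\<close> available for Pythagoras and for the variational argument.\<close>

lemma of_real_inner: "of_real (2 * inner x y) = hinner x y + hinner y x"
proof -
  have "of_real ((norm (x + y))\<^sup>2) = hinner x x + hinner x y + hinner y x + hinner y y"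
    unfolding hinner_self[symmetric] by (simp add: hinner_add_left hinner_add_right)
  moreover have "(norm (x + y))\<^sup>2 = (norm x)\<^sup>2 + 2 * inner x y + (norm y)\<^sup>2"
    by (simp add: power2_norm_eq_inner inner_add inner_commute)
  ultimately show ?thesis
    by (simp add: hinner_self)
qed

lemma inner_eq_0_if_hinner: "hinner x y = 0 \<Longrightarrow> inner x y = 0"
  using of_real_inner[of x y] hinner_commute_eq_0[of x y]
  by (metis add.right_neutral of_real_eq_0_iff mult_eq_0_iff zero_neq_numeral)

lemma norm_hinner_le: "norm (hinner x y) \<le> norm x * norm y"
proof -
  have "norm (hinner x y) \<le> (\<Sum>i\<in>UNIV. \<bar>norm (x $ i)\<bar> * \<bar>norm (y $ i)\<bar>)"
    unfolding hinner_def by (rule order_trans[OF norm_sum]) (simp add: norm_mult)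
  also have "\<dots> \<le> norm x * norm y"
    unfolding norm_vec_def by (rule L2_set_mult_ineq)
  finally show ?thesis .
qed

lemma norm_vconj [simp]: "norm (vconj x) = norm x"
  by (simp add: vconj_def norm_vec_def)

lemma hinner_vconj [simp]: "hinner (vconj x) (vconj y) = conjugate (hinner x y)"
  by (simp add: hinner_def vconj_def conjugate_sum conjugate_mult)

lemma hinner_adjoint: "hinner (M *v x) y = hinner x (conj_transpose M *v y)"
proof -
  have "hinner (M *v x) y = (\<Sum>i\<in>UNIV. \<Sum>j\<in>UNIV. M $ i $ j * x $ j * conjugate (y $ i))"
    by (simp add: hinner_def matrix_vector_mult_def sum_distrib_right)
  also have "\<dots> = (\<Sum>j\<in>UNIV. \<Sum>i\<in>UNIV. M $ i $ j * x $ j * conjugate (y $ i))"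
    by (rule sum.swap)
  also have "\<dots> = hinner x (conj_transpose M *v y)"
    by (simp add: hinner_def matrix_vector_mult_def conj_transpose_def conjugate_sum
        conjugate_mult sum_distrib_left mult_ac)
  finally show ?thesis .
qed

lemma continuous_on_hinner_left: "continuous_on S (\<lambda>x. hinner x y)"
  unfolding hinner_def by (intro continuous_intros)

section \<open>Orthonormal families: expansion, Bessel and Parseval\<close>

definition orthonormal :: "'i set \<Rightarrow> ('i \<Rightarrow> 'a::real_or_complex^'n) \<Rightarrow> bool" where
  "orthonormal I v \<longleftrightarrow>
    (\<forall>i\<in>I. norm (v i) = 1) \<and> (\<forall>i\<in>I. \<forall>j\<in>I. i \<noteq> j \<longrightarrow> hinner (v i) (v j) = 0)"

lemma orthonormal_hinner:
  "orthonormal I v \<Longrightarrow> i \<in> I \<Longrightarrow> j \<in> I \<Longrightarrow> hinner (v i) (v j) = (if i = j then 1 else 0)"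
  by (simp add: orthonormal_def hinner_self)

lemma hinner_orthonormal_sum:
  assumes "orthonormal I v" "finite I" "i \<in> I"
  shows "hinner (\<Sum>j\<in>I. c j *s v j) (v i) = c i"
proof -
  have "hinner (\<Sum>j\<in>I. c j *s v j) (v i) = (\<Sum>j\<in>I. if j = i then c j else 0)"
    unfolding hinner_sum_left using assms
    by (intro sum.cong) (simp_all add: orthonormal_hinner)
  then show ?thesis using assms by simp
qed

lemma orthonormal_inj_on: "orthonormal I v \<Longrightarrow> inj_on v I"
  by (rule inj_onI) (metis orthonormal_hinner zero_neq_one)

lemma orthonormal_independent:
  assumes "orthonormal I v" "finite I"
  shows "vec.independent (v ` I)"
proof -
  have inj: "inj_on v I" using assms(1) by (rule orthonormal_inj_on)
  have "u x = 0" if "(\<Sum>x\<in>v ` I. u x *s x) = 0" "x \<in> v ` I" for u x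
  proof -
    from that(2) obtain i where i: "i \<in> I" "x = v i" by auto
    have "(\<Sum>j\<in>I. u (v j) *s v j) = 0"
      using that(1) by (simp add: sum.reindex[OF inj])
    with hinner_orthonormal_sum[OF assms i(1), of "\<lambda>j. u (v j)"] i show ?thesis by simp
  qed
  then show ?thesis using vec.dependent_finite[of "v ` I"] assms(2) by auto
qed

lemma orthonormal_residual:
  assumes "orthonormal I v" "finite I" "i \<in> I"
  shows "hinner (x - (\<Sum>j\<in>I. hinner x (v j) *s v j)) (v i) = 0"
  using hinner_orthonormal_sum[OF assms] by (simp add: hinner_diff_left)

lemma norm_orthogonal_sum:
  assumes "finite I" "\<And>i j. i \<in> I \<Longrightarrow> j \<in> I \<Longrightarrow> i \<noteq> j \<Longrightarrow> hinner (w i) (w j) = 0"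
  shows "(norm (\<Sum>i\<in>I. w i))\<^sup>2 = (\<Sum>i\<in>I. (norm (w i))\<^sup>2)"
proof -
  have "of_real ((norm (\<Sum>i\<in>I. w i))\<^sup>2) = (\<Sum>i\<in>I. \<Sum>j\<in>I. hinner (w i) (w j))"
    unfolding hinner_self[symmetric] hinner_sum_left by (simp add: hinner_sum_right)
  also have "\<dots> = (\<Sum>i\<in>I. \<Sum>j\<in>I. if i = j then hinner (w i) (w i) else 0)"
    using assms(2) by (intro sum.cong) auto
  also have "\<dots> = of_real (\<Sum>i\<in>I. (norm (w i))\<^sup>2)"
    using assms(1) by (simp add: hinner_self)
  finally show ?thesis by (simp only: of_real_eq_iff)
qed

lemma norm_orthonormal_sum:
  assumes "orthonormal I v" "finite I"
  shows "(norm (\<Sum>i\<in>I. c i *s v i))\<^sup>2 = (\<Sum>i\<in>I. (norm (c i))\<^sup>2)"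
  using assms
  by (subst norm_orthogonal_sum) (simp_all add: orthonormal_hinner, simp add: orthonormal_def)

text \<open>Pythagoras for \<open>x = (x - p) + p\<close>, where \<open>p\<close> is the orthogonal
  projection of \<open>x\<close> to the span of the family.\<close>

lemma bessel:
  assumes "orthonormal I v" "finite I"
  shows "(\<Sum>i\<in>I. (norm (hinner x (v i)))\<^sup>2) \<le> (norm x)\<^sup>2"
proof -
  define p where "p = (\<Sum>i\<in>I. hinner x (v i) *s v i)"
  have "hinner (x - p) p = 0"
    unfolding p_def hinner_sum_right hinner_smult_right
    using orthonormal_residual[OF assms, of _ x] by simp
  then have "inner (x - p) p = 0" by (rule inner_eq_0_if_hinner)
  then have "(norm x)\<^sup>2 = (norm (x - p))\<^sup>2 + (norm p)\<^sup>2"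
    by (simp add: power2_norm_eq_inner inner_diff inner_commute)
  then show ?thesis
    using norm_orthonormal_sum[OF assms, of "\<lambda>i. hinner x (v i)"]
    by (simp add: p_def)
qed

text \<open>Fewer than \<open>CARD('n)\<close> vectors do not span, so some \<open>y\<close> lies
  outside their span; subtracting its projection leaves a nonzero vector orthogonal to all of
  them.\<close>

lemma orthonormal_extend:
  fixes v :: "nat \<Rightarrow> 'a::real_or_complex^'n"
  assumes "orthonormal {..<k} v" "k < CARD('n)"
  obtains x where "x \<noteq> 0" "\<And>i. i < k \<Longrightarrow> hinner x (v i) = 0"
proof -
  have "vec.dim (vec.span (v ` {..<k})) \<le> card (v ` {..<k})"
    unfolding vec.dim_span by (intro vec.dim_le_card vec.span_superset) simp
  also have "\<dots> \<le> k" using card_image_le[of "{..<k}" v] by simp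
  finally have "vec.span (v ` {..<k}) \<noteq> UNIV"
    using assms(2) vec_dim_card[where 'a='a and 'n='n] by (metis not_less)
  then obtain y where y: "y \<notin> vec.span (v ` {..<k})" by auto
  define p where "p = (\<Sum>j<k. hinner y (v j) *s v j)"
  have "p \<in> vec.span (v ` {..<k})"
    unfolding p_def by (intro vec.span_sum vec.span_scale vec.span_base) auto
  then have "y - p \<noteq> 0" using y by auto
  moreover have "hinner (y - p) (v i) = 0" if "i < k" for i
    using orthonormal_residual[OF assms(1), of i y] that by (simp add: p_def)
  ultimately show ?thesis using that by blast
qed

text \<open>Orthonormal vectors are independent, so \<open>CARD('n)\<close> of them span the space;
  pairing with \<open>v i\<close> then identifies the coefficients.\<close>

lemma orthonormal_expansion:
  fixes v :: "nat \<Rightarrow> 'a::real_or_complex^'n"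
  assumes "orthonormal {..<CARD('n)} v"
  shows "x = (\<Sum>i<CARD('n). hinner x (v i) *s v i)"
proof -
  have "card (v ` {..<CARD('n)}) = CARD('n)"
    using orthonormal_inj_on[OF assms] by (simp add: card_image)
  then have "vec.span (v ` {..<CARD('n)}) = UNIV"
    using vec.card_ge_dim_independent[of "v ` {..<CARD('n)}" UNIV]
      orthonormal_independent[OF assms] unfolding vec_dim_card by auto
  then have "x \<in> vec.span (v ` {..<CARD('n)})" by simp
  then have "x \<in> range (\<lambda>u. \<Sum>y\<in>v ` {..<CARD('n)}. u y *s y)"
    by (simp add: vec.span_finite)
  then obtain c where x: "x = (\<Sum>i<CARD('n). c (v i) *s v i)"
    using sum.reindex[OF orthonormal_inj_on[OF assms]] by (auto simp: o_def)
  have "hinner x (v i) = c (v i)" if "i < CARD('n)" for i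
    using hinner_orthonormal_sum[OF assms, of i "\<lambda>i. c (v i)"] that x by simp
  then show ?thesis using x by simp
qed

lemma parseval:
  fixes v :: "nat \<Rightarrow> 'a::real_or_complex^'n"
  assumes "orthonormal {..<CARD('n)} v"
  shows "(norm x)\<^sup>2 = (\<Sum>i<CARD('n). (norm (hinner x (v i)))\<^sup>2)"
  using norm_orthonormal_sum[OF assms, of "\<lambda>i. hinner x (v i)"]
    orthonormal_expansion[OF assms, of x] by simp

section \<open>Singular bases\<close>

text \<open>A first-order condition: moving the maximiser \<open>v\<close> in a direction orthogonal
  to it changes the norm of the vector only to second order, so the first-order change of the norm
  of its image must vanish. This settles the real inner product, from which the Hermitian one
  follows.\<close>

lemma orthogonal_images_of_maximizer:
  fixes M :: "'a::real_or_complex^'n^'m"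
  assumes S: "vec.subspace S" and v: "v \<in> S" "norm v = 1"
    and max: "\<And>y. y \<in> S \<Longrightarrow> norm (M *v y) \<le> norm (M *v v) * norm y"
    and x: "x \<in> S" "hinner x v = 0"
  shows "hinner (M *v v) (M *v x) = 0"
proof -
  have real: "inner (M *v v) (M *v w) = 0" if w: "w \<in> S" "hinner w v = 0" for w
  proof -
    define \<alpha> where "\<alpha> = inner (M *v v) (M *v w)"
    define K where "K = (norm (M *v v))\<^sup>2 * (norm w)\<^sup>2"
    have vw: "inner v w = 0"
      using w(2) inner_eq_0_if_hinner hinner_commute_eq_0 by metis
    \<comment> \<open>Maximality at \<open>v + t *\<^sub>R w\<close>. A term linear in
      \<open>t\<close> is bounded by a quadratic one for every real \<open>t\<close>, which forces
      \<open>\<alpha> = 0\<close>.\<close>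
    have *: "2 * t * \<alpha> \<le> t\<^sup>2 * K" for t
    proof -
      have "v + t *\<^sub>R w \<in> S"
        unfolding scaleR_eq_smult
        using S v w by (intro vec.subspace_add vec.subspace_scale)
      then have "(norm (M *v (v + t *\<^sub>R w)))\<^sup>2 \<le> (norm (M *v v))\<^sup>2 * (norm (v + t *\<^sub>R w))\<^sup>2"
        unfolding power_mult_distrib[symmetric] using max by (intro power_mono) auto
      also have "(norm (v + t *\<^sub>R w))\<^sup>2 = 1 + t\<^sup>2 * (norm w)\<^sup>2"
        using vw v(2) unfolding power2_norm_eq_inner
        by (simp add: inner_add inner_commute norm_eq_1 power2_eq_square)
      also have "(norm (M *v v))\<^sup>2 * (1 + t\<^sup>2 * (norm w)\<^sup>2) = (norm (M *v v))\<^sup>2 + t\<^sup>2 * K"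
        by (simp add: K_def algebra_simps)
      also have "(norm (M *v (v + t *\<^sub>R w)))\<^sup>2
        = (norm (M *v v))\<^sup>2 + 2 * t * \<alpha> + t\<^sup>2 * (norm (M *v w))\<^sup>2"
        unfolding \<alpha>_def power2_norm_eq_inner matrix_vector_right_distrib mult_vec_scaleR
        by (simp add: inner_add inner_commute power2_eq_square)
      finally show ?thesis
        using mult_nonneg_nonneg[OF zero_le_power2[of t] zero_le_power2[of "norm (M *v w)"]]
        by linarith
    qed
    have K: "0 \<le> K" by (simp add: K_def)
    \<comment> \<open>The denominator \<open>K + 1\<close> stays positive also for
      \<open>K = 0\<close>, and this \<open>t\<close> turns the bound into
      \<open>t\<^sup>2 * (K + 2) \<le> 0\<close>.\<close>
    define t where "t = \<alpha> / (K + 1)"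
    have \<alpha>: "\<alpha> = t * (K + 1)" using K by (simp add: t_def)
    have "t\<^sup>2 * (K + 2) \<le> 0"
      using *[of t] unfolding \<alpha> by (simp add: power2_eq_square algebra_simps)
    then have "t\<^sup>2 \<le> 0" using K by (simp add: mult_le_0_iff)
    then show ?thesis using \<alpha> by (simp add: \<alpha>_def)
  qed
  \<comment> \<open>Scaling \<open>x\<close> by the Hermitian product \<open>h\<close> itself makes
    the new product the real number \<open>(norm h)\<^sup>2\<close>, which the real case shows to be
    zero.\<close>
  define h where "h = hinner (M *v v) (M *v x)"
  have "inner (M *v v) (M *v (h *s x)) = 0"
    using S x by (intro real) (auto intro: vec.subspace_scale)
  then have "0 = hinner (M *v v) (M *v (h *s x)) + hinner (M *v (h *s x)) (M *v v)"
    using of_real_inner[of "M *v v" "M *v (h *s x)"] by simp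
  also have "hinner (M *v v) (M *v (h *s x)) = of_real ((norm h)\<^sup>2)"
    unfolding h_def[symmetric] vector_scalar_commute hinner_smult_right
    by (simp add: mult.commute mult_conjugate_of_real)
  also have "hinner (M *v (h *s x)) (M *v v) = of_real ((norm h)\<^sup>2)"
    unfolding vector_scalar_commute hinner_smult_left hinner_commute[of "M *v x"]
    by (simp add: h_def[symmetric] mult_conjugate_of_real)
  finally have "of_real (2 * (norm h)\<^sup>2) = (0::'a)" by simp
  then have "2 * (norm h)\<^sup>2 = 0" by (simp only: of_real_eq_0_iff)
  then show ?thesis by (simp add: h_def)
qed

text \<open>The unit sphere of \<open>S\<close> is compact, and nonempty since it contains the
  normalised \<open>x\<close>. The bound is put in homogeneous form so that it covers vectors of any
  length.\<close>

lemma exists_maximizer: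
  fixes M :: "'a::real_or_complex^'n^'m"
  assumes S: "vec.subspace S" "closed S" and x: "x \<in> S" "x \<noteq> 0"
  obtains v where "v \<in> S" "norm v = 1"
    "\<And>y. y \<in> S \<Longrightarrow> norm (M *v y) \<le> norm (M *v v) * norm y"
proof -
  have unit: "(1 / norm y) *\<^sub>R y \<in> S \<inter> sphere 0 1" if "y \<in> S" "y \<noteq> 0" for y
    using that S(1) unfolding scaleR_eq_smult
    by (auto intro!: vec.subspace_scale) (simp add: norm_divide)
  have "compact (S \<inter> sphere 0 1)"
    using S(2) by (intro closed_Int_compact) auto
  moreover have "S \<inter> sphere 0 1 \<noteq> {}"
    using unit[OF x] by blast
  moreover have "continuous_on (S \<inter> sphere 0 1) (\<lambda>y. norm (M *v y))"
    by (intro continuous_on_norm linear_continuous_on matrix_vector_mul_bounded_linear)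
  ultimately obtain v where "v \<in> S \<inter> sphere 0 1"
    and max: "\<And>y. y \<in> S \<inter> sphere 0 1 \<Longrightarrow> norm (M *v y) \<le> norm (M *v v)"
    using continuous_attains_sup[of "S \<inter> sphere 0 1" "\<lambda>y. norm (M *v y)"] by blast
  then have v: "v \<in> S" "norm v = 1" by auto
  have "norm (M *v y) \<le> norm (M *v v) * norm y" if "y \<in> S" for y
  proof (cases "y = 0")
    case False
    then show ?thesis
      using max[OF unit[OF that False]]
      by (simp add: mult_vec_scaleR divide_simps mult.commute)
  qed simp
  then show ?thesis using v that by blast
qed

text \<open>A full set of right singular vectors in no particular order. Orthogonality of the images
  replaces the eigenvector equation, and left singular vectors are left out because they are
  undetermined where \<open>M *v v i = 0\<close>.\<close>

definition singular_basis :: "'a::real_or_complex^'n^'m \<Rightarrow> (nat \<Rightarrow> 'a^'n) \<Rightarrow> bool" where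
  "singular_basis M v \<longleftrightarrow> orthonormal {..<CARD('n)} v \<and>
    (\<forall>i<CARD('n). \<forall>j<CARD('n). i \<noteq> j \<longrightarrow> hinner (M *v v i) (M *v v j) = 0)"

lemma singular_basis_exists:
  fixes M :: "'a::real_or_complex^'n^'m"
  obtains v where "singular_basis M v"
proof -
  \<comment> \<open>The third clause is the invariant that carries the induction: the images of the
    chosen vectors are orthogonal to the image of the whole orthogonal complement, hence to the
    image of the next vector, a maximiser in that complement.\<close>
  have "\<exists>v. orthonormal {..<k} v \<and>
      (\<forall>i<k. \<forall>j<k. i \<noteq> j \<longrightarrow> hinner (M *v v i) (M *v v j) = 0) \<and>
      (\<forall>i<k. \<forall>x. (\<forall>j<k. hinner x (v j) = 0) \<longrightarrow> hinner (M *v v i) (M *v x) = 0)"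
    if "k \<le> CARD('n)" for k
    using that
  proof (induction k)
    case 0
    show ?case by (simp add: orthonormal_def)
  next
    case (Suc k)
    then obtain v where on: "orthonormal {..<k} v"
      and pair: "\<And>i j. i < k \<Longrightarrow> j < k \<Longrightarrow> i \<noteq> j \<Longrightarrow> hinner (M *v v i) (M *v v j) = 0"
      and comp: "\<And>i x. i < k \<Longrightarrow> (\<And>j. j < k \<Longrightarrow> hinner x (v j) = 0)
        \<Longrightarrow> hinner (M *v v i) (M *v x) = 0"
      by auto
    define S where "S = {x. \<forall>j\<in>{..<k}. hinner x (v j) = 0}"
    have S: "vec.subspace S"
      by (simp add: S_def vec.subspace_def hinner_add_left)
    have "S = (\<Inter>j<k. {x. hinner x (v j) = 0})"
      by (auto simp: S_def)
    then have "closed S"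
      by (auto intro!: closed_INT closed_Collect_eq continuous_on_hinner_left continuous_on_const)
    obtain x where "x \<in> S" "x \<noteq> 0"
      by (rule orthonormal_extend[OF on]) (use Suc.prems in \<open>auto simp: S_def\<close>)
    then obtain w where w: "w \<in> S" "norm w = 1"
      and max: "\<And>y. y \<in> S \<Longrightarrow> norm (M *v y) \<le> norm (M *v w) * norm y"
      using exists_maximizer[OF S \<open>closed S\<close>] by metis
    have wv: "hinner w (v j) = 0" "hinner (v j) w = 0" if "j < k" for j
      using w(1) that hinner_commute_eq_0[of w "v j"] by (auto simp: S_def)
    have Mw: "hinner (M *v v i) (M *v w) = 0" "hinner (M *v w) (M *v v i) = 0" if "i < k" for i
      using comp[OF that wv(1)] hinner_commute_eq_0 by auto
    define u where "u = v(k := w)"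
    have "orthonormal {..<Suc k} u"
      using on w(2) wv by (auto simp: orthonormal_def u_def less_Suc_eq)
    moreover have "hinner (M *v u i) (M *v u j) = 0" if "i < Suc k" "j < Suc k" "i \<noteq> j" for i j
      using that pair Mw by (auto simp: u_def less_Suc_eq)
    moreover have "hinner (M *v u i) (M *v x) = 0"
      if "i < Suc k" "\<forall>j<Suc k. hinner x (u j) = 0" for i x
    proof -
      have xw: "hinner x w = 0" and xv: "\<And>j. j < k \<Longrightarrow> hinner x (v j) = 0"
        using that(2) by (auto simp: u_def less_Suc_eq)
      then have "hinner (M *v w) (M *v x) = 0"
        by (intro orthogonal_images_of_maximizer[OF S w max]) (auto simp: S_def)
      then show ?thesis
        using comp[of i x] xv that(1) by (auto simp: u_def less_Suc_eq)
    qed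
    ultimately show ?case by blast
  qed
  from this[of "CARD('n)"] show ?thesis
    using that by (auto simp: singular_basis_def)
qed

section \<open>Eigenspaces of \<open>M^*M\<close> and the two matrix norms\<close>

lemma orthonormal_eqI:
  fixes v :: "nat \<Rightarrow> 'a::real_or_complex^'n"
  assumes "orthonormal {..<CARD('n)} v" "\<And>i. i < CARD('n) \<Longrightarrow> hinner x (v i) = hinner y (v i)"
  shows "x = y"
  using orthonormal_expansion[OF assms(1), of x] orthonormal_expansion[OF assms(1), of y] assms(2)
  by simp

lemma hinner_adjoint_left: "hinner (conj_transpose M *v y) x = hinner y (M *v x)"
  by (metis hinner_adjoint hinner_commute)

lemma singular_basis_orthonormal:
  fixes v :: "nat \<Rightarrow> 'a::real_or_complex^'n"
  shows "singular_basis M v \<Longrightarrow> orthonormal {..<CARD('n)} v"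
  by (simp add: singular_basis_def)

lemma singular_basis_eigenvector:
  fixes v :: "nat \<Rightarrow> 'a::real_or_complex^'n"
  assumes "singular_basis M v" "i < CARD('n)"
  shows "conj_transpose M *v (M *v v i) = of_real ((norm (M *v v i))\<^sup>2) *s v i"
proof (rule orthonormal_eqI[OF singular_basis_orthonormal[OF assms(1)]])
  fix j assume "j < CARD('n)"
  then show "hinner (conj_transpose M *v (M *v v i)) (v j)
      = hinner (of_real ((norm (M *v v i))\<^sup>2) *s v i) (v j)"
    using assms hinner_self[of "M *v v i"] orthonormal_hinner[OF singular_basis_orthonormal[OF assms(1)]]
    by (cases "i = j") (simp_all add: hinner_adjoint_left singular_basis_def)
qed

text \<open>In the basis \<open>v\<close> the matrix \<open>M^*M\<close> is diagonal with entries
  \<open>(norm (M *v v i))\<^sup>2\<close>, so an eigenvector for \<open>t\<^sup>2\<close> has no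
  component along the other \<open>v i\<close>. For \<open>t \<ge> 0\<close> the squares may be
  compared without the squaring.\<close>

lemma singular_space_iff:
  fixes v :: "nat \<Rightarrow> 'a::real_or_complex^'n"
  assumes v: "singular_basis M v" and "0 \<le> t"
  shows "x \<in> singular_space M t \<longleftrightarrow> (\<forall>i<CARD('n). norm (M *v v i) \<noteq> t \<longrightarrow> hinner x (v i) = 0)"
proof -
  have *: "hinner (conj_transpose M *v (M *v x)) (v i) = of_real ((norm (M *v v i))\<^sup>2) * hinner x (v i)"
    if "i < CARD('n)" for i
    unfolding hinner_adjoint_left
    by (simp add: hinner_adjoint[of M x] singular_basis_eigenvector[OF v that] del: of_real_power)
  have sq: "(norm (M *v v i))\<^sup>2 = t\<^sup>2 \<longleftrightarrow> norm (M *v v i) = t" for i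
    using assms(2) by (simp add: power2_eq_iff_nonneg)
  have "x \<in> singular_space M t \<longleftrightarrow> conj_transpose M *v (M *v x) = of_real (t\<^sup>2) *s x"
    by (simp add: singular_space_def matrix_vector_mul_assoc)
  also have "\<dots> \<longleftrightarrow> (\<forall>i<CARD('n). hinner (conj_transpose M *v (M *v x)) (v i)
      = hinner (of_real (t\<^sup>2) *s x) (v i))"
    using orthonormal_eqI[OF singular_basis_orthonormal[OF v]] by metis
  also have "\<dots> \<longleftrightarrow> (\<forall>i<CARD('n). hinner x (v i) = 0 \<or> (of_real ((norm (M *v v i))\<^sup>2) :: 'a) = of_real (t\<^sup>2))"
    using * by (simp del: of_real_power)
  finally show ?thesis unfolding of_real_eq_iff sq by blast
qed

lemma singular_values_eq:
  fixes v :: "nat \<Rightarrow> 'a::real_or_complex^'n"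
  assumes v: "singular_basis M v"
  shows "singular_values M = (\<lambda>i. norm (M *v v i)) ` {..<CARD('n)}"
proof (intro equalityI subsetI)
  fix t assume "t \<in> singular_values M"
  then obtain x where x: "0 \<le> t" "x \<in> singular_space M t" "x \<noteq> 0"
    by (auto simp: singular_values_def)
  then have "\<exists>i<CARD('n). norm (M *v v i) = t"
    using singular_space_iff[OF v x(1)] orthonormal_eqI[OF singular_basis_orthonormal[OF v], of x 0]
    by auto
  then show "t \<in> (\<lambda>i. norm (M *v v i)) ` {..<CARD('n)}" by auto
next
  fix t assume "t \<in> (\<lambda>i. norm (M *v v i)) ` {..<CARD('n)}"
  then obtain i where i: "i < CARD('n)" "t = norm (M *v v i)" by auto
  then have "v i \<in> singular_space M t"
    using orthonormal_hinner[OF singular_basis_orthonormal[OF v]]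
    by (subst singular_space_iff[OF v]) auto
  moreover have "v i \<noteq> 0"
    using v i(1) by (force simp: singular_basis_def orthonormal_def)
  ultimately show "t \<in> singular_values M"
    using i(2) by (auto simp: singular_values_def)
qed

lemma orthonormal_subset: "orthonormal I v \<Longrightarrow> J \<subseteq> I \<Longrightarrow> orthonormal J v"
  by (auto simp: orthonormal_def)

text \<open>The \<open>v i\<close> whose image has norm \<open>t\<close> form a basis of the
  eigenspace, so multiplicities can be counted on indices.\<close>

lemma dim_singular_space:
  fixes v :: "nat \<Rightarrow> 'a::real_or_complex^'n"
  assumes v: "singular_basis M v" and "0 \<le> t"
  shows "vec.dim (singular_space M t) = card {i \<in> {..<CARD('n)}. norm (M *v v i) = t}"
proof -
  define J where "J = {i \<in> {..<CARD('n)}. norm (M *v v i) = t}"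
  have J: "orthonormal J v" "finite J" "J \<subseteq> {..<CARD('n)}"
    by (auto simp: J_def intro: orthonormal_subset[OF singular_basis_orthonormal[OF v]])
  have "singular_space M t \<subseteq> vec.span (v ` J)"
  proof
    fix x assume "x \<in> singular_space M t"
    then have "hinner x (v i) = 0" if "i < CARD('n)" "i \<notin> J" for i
      using that singular_space_iff[OF assms] by (auto simp: J_def)
    then have "(\<Sum>i<CARD('n). hinner x (v i) *s v i) = (\<Sum>i\<in>J. hinner x (v i) *s v i)"
      using J by (intro sum.mono_neutral_right) auto
    then have "x = (\<Sum>i\<in>J. hinner x (v i) *s v i)"
      using orthonormal_expansion[OF singular_basis_orthonormal[OF v], of x] by simp
    also have "\<dots> \<in> vec.span (v ` J)"
      by (intro vec.span_sum vec.span_scale vec.span_base) auto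
    finally show "x \<in> vec.span (v ` J)" .
  qed
  moreover have "v ` J \<subseteq> singular_space M t"
    using orthonormal_hinner[OF singular_basis_orthonormal[OF v]]
    by (auto simp: J_def singular_space_iff[OF v])
  moreover have "card (v ` J) = card J"
    using orthonormal_inj_on[OF J(1)] by (rule card_image)
  ultimately show ?thesis
    unfolding J_def[symmetric] by (intro vec.dim_unique) (simp_all add: orthonormal_independent[OF J(1,2)])
qed

text \<open>Grouping the indices by the value of \<open>norm (M *v v i)\<close> yields each singular
  value as often as its multiplicity.\<close>

lemma matrix_nuclear_norm_eq:
  fixes v :: "nat \<Rightarrow> 'a::real_or_complex^'n"
  assumes v: "singular_basis M v"
  shows "matrix_nuclear_norm M = (\<Sum>i<CARD('n). norm (M *v v i))"
proof -
  have "(\<Sum>i<CARD('n). norm (M *v v i)) = (\<Sum>t\<in>(\<lambda>i. norm (M *v v i)) ` {..<CARD('n)}.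
      \<Sum>i\<in>{i \<in> {..<CARD('n)}. norm (M *v v i) = t}. norm (M *v v i))"
    by (rule sum.image_gen) simp
  also have "\<dots> = matrix_nuclear_norm M"
    unfolding matrix_nuclear_norm_def singular_values_eq[OF v]
    by (intro sum.cong) (auto simp: dim_singular_space[OF v])
  finally show ?thesis by simp
qed

lemma matrix_spectral_norm_eq:
  fixes v :: "nat \<Rightarrow> 'a::real_or_complex^'n"
  assumes v: "singular_basis M v"
  shows "matrix_spectral_norm M = Max ((\<lambda>i. norm (M *v v i)) ` {..<CARD('n)})"
  by (simp add: matrix_spectral_norm_def singular_values_eq[OF v])

lemma lessThan_card_nonempty: "{..<CARD('n::finite)} \<noteq> {}"
  by (metis lessThan_empty_iff zero_less_card_finite less_numeral_extra(3))

text \<open>The maximum is taken at some \<open>v i\<close>. The eigenvector equation is included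
  because it later identifies a contraction of the tensor with a multiple of the conjugate of
  \<open>x\<close>.\<close>

lemma matrix_spectral_norm_attained:
  fixes M :: "'a::real_or_complex^'n^'m"
  obtains x where "norm x = 1" "norm (M *v x) = matrix_spectral_norm M"
    "conj_transpose M *v (M *v x) = of_real ((matrix_spectral_norm M)\<^sup>2) *s x"
proof -
  obtain v where v: "singular_basis M v" by (rule singular_basis_exists)
  have "matrix_spectral_norm M \<in> (\<lambda>i. norm (M *v v i)) ` {..<CARD('n)}"
    unfolding matrix_spectral_norm_eq[OF v] by (rule Max_in) (simp_all add: lessThan_card_nonempty)
  then obtain i where "i < CARD('n)" "matrix_spectral_norm M = norm (M *v v i)" by auto
  then show ?thesis
    using that[of "v i"] singular_basis_eigenvector[OF v] v
    by (simp add: singular_basis_def orthonormal_def)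
qed

lemma matrix_spectral_norm_nonneg: "0 \<le> matrix_spectral_norm M"
  by (metis matrix_spectral_norm_attained norm_ge_zero)

text \<open>Expand \<open>x\<close> in a singular basis: the images are orthogonal, and each is
  stretched by at most the largest singular value.\<close>

lemma norm_mult_vec_le:
  fixes M :: "'a::real_or_complex^'n^'m"
  shows "norm (M *v x) \<le> matrix_spectral_norm M * norm x"
proof -
  obtain v where v: "singular_basis M v" by (rule singular_basis_exists)
  note on = singular_basis_orthonormal[OF v]
  let ?s = "matrix_spectral_norm M"
  have s: "norm (M *v v i) \<le> ?s" if "i < CARD('n)" for i
    unfolding matrix_spectral_norm_eq[OF v] using that by (intro Max_ge) auto
  have "M *v x = M *v (\<Sum>i<CARD('n). hinner x (v i) *s v i)"
    using orthonormal_expansion[OF on, of x] by simp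
  also have "\<dots> = (\<Sum>i<CARD('n). hinner x (v i) *s (M *v v i))"
    by (simp add: vec.linear_sum[OF matrix_vector_mul_linear_gen] vector_scalar_commute)
  finally have "(norm (M *v x))\<^sup>2 = (\<Sum>i<CARD('n). (norm (hinner x (v i) *s (M *v v i)))\<^sup>2)"
    using v by (simp only:, intro norm_orthogonal_sum) (simp_all add: singular_basis_def)
  also have "\<dots> \<le> (\<Sum>i<CARD('n). (norm (hinner x (v i)))\<^sup>2 * ?s\<^sup>2)"
    using s by (intro sum_mono) (simp add: power_mult_distrib mult_left_mono power_mono)
  also have "\<dots> = (?s * norm x)\<^sup>2"
    by (simp add: parseval[OF on, of x] power_mult_distrib sum_distrib_left mult.commute)
  finally show ?thesis
    by (rule power2_le_imp_le) (simp add: matrix_spectral_norm_nonneg)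
qed

section \<open>Frobenius norm, rank and sums of dyads\<close>

lemma hinner_vconj_row: "hinner x (vconj (M $ i)) = (M *v x) $ i"
  by (simp add: hinner_def vconj_def matrix_vector_mult_def mult.commute)

text \<open>The norm of a matrix type is the Frobenius norm. Parseval applies to each conjugated
  row, whose coefficients are, up to conjugation, entries of the images
  \<open>M *v v i\<close>.\<close>

lemma norm_square_eq_sum_orthonormal:
  fixes M :: "'a::real_or_complex^'n^'m" and v :: "nat \<Rightarrow> 'a^'n"
  assumes "orthonormal {..<CARD('n)} v"
  shows "(norm M)\<^sup>2 = (\<Sum>i<CARD('n). (norm (M *v v i))\<^sup>2)"
proof -
  have "(norm M)\<^sup>2 = (\<Sum>a\<in>UNIV. (norm (vconj (M $ a)))\<^sup>2)"
    unfolding norm_vconj by (simp add: norm_vec_def[of M] L2_set_def sum_nonneg)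
  also have "\<dots> = (\<Sum>a\<in>UNIV. \<Sum>i<CARD('n). (norm ((M *v v i) $ a))\<^sup>2)"
    unfolding parseval[OF assms] hinner_vconj_row[symmetric]
    by (subst hinner_commute) simp
  also have "\<dots> = (\<Sum>i<CARD('n). \<Sum>a\<in>UNIV. (norm ((M *v v i) $ a))\<^sup>2)"
    by (rule sum.swap)
  finally show ?thesis by (simp add: norm_vec_square)
qed

text \<open>This is \<open>M\<close> applied to the resolution of the identity by the dyads
  \<open>v_i v_i^*\<close>; for a singular basis it is the singular value decomposition.\<close>

lemma orthonormal_dyadic_expansion:
  fixes M :: "'a::real_or_complex^'n^'m" and v :: "nat \<Rightarrow> 'a^'n"
  assumes "orthonormal {..<CARD('n)} v"
  shows "M $ a $ b = (\<Sum>i<CARD('n). (M *v v i) $ a * conjugate (v i $ b))"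
proof -
  have "conjugate (M $ a $ b) = vconj (M $ a) $ b"
    by (simp add: vconj_def)
  also have "\<dots> = (\<Sum>i<CARD('n). hinner (vconj (M $ a)) (v i) * v i $ b)"
    by (subst orthonormal_expansion[OF assms]) simp
  also have "\<dots> = (\<Sum>i<CARD('n). conjugate ((M *v v i) $ a) * v i $ b)"
    by (subst hinner_commute) (simp add: hinner_vconj_row)
  finally have "conjugate (conjugate (M $ a $ b))
      = conjugate (\<Sum>i<CARD('n). conjugate ((M *v v i) $ a) * v i $ b)"
    by simp
  then show ?thesis by (simp add: conjugate_sum conjugate_mult)
qed

text \<open>The rank is the dimension of the row space, so the right singular vectors have to be
  conjugated.\<close>

lemma card_nonzero_singular_le_rank:
  fixes v :: "nat \<Rightarrow> 'a::real_or_complex^'n"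
  assumes v: "singular_basis M v"
  shows "card {i \<in> {..<CARD('n)}. norm (M *v v i) \<noteq> 0} \<le> rank M"
proof -
  define J where "J = {i \<in> {..<CARD('n)}. norm (M *v v i) \<noteq> 0}"
  define w where "w i = vconj (v i)" for i
  have "orthonormal J v"
    by (auto simp: J_def intro!: orthonormal_subset[OF singular_basis_orthonormal[OF v]])
  then have w: "orthonormal J w"
    by (auto simp: orthonormal_def w_def)
  have "w i \<in> vec.span (rows M)" if "i \<in> J" for i
  proof -
    define s where "s = (of_real ((norm (M *v v i))\<^sup>2) :: 'a)"
    have i: "i < CARD('n)" "s \<noteq> 0" using that by (auto simp: J_def s_def)
    \<comment> \<open>The conjugated eigenvector equation writes \<open>s *s w i\<close> as a
      combination of rows of \<open>M\<close>, and \<open>s\<close> is invertible for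
      \<open>i \<in> J\<close>.\<close>
    have "s *s w i = vconj (s *s v i)"
      by (simp add: w_def vconj_def vec_eq_iff conjugate_mult s_def del: of_real_power)
    also have "\<dots> = vconj (conj_transpose M *v (M *v v i))"
      by (simp only: singular_basis_eigenvector[OF v i(1)] s_def)
    also have "\<dots> = (\<Sum>a\<in>UNIV. conjugate ((M *v v i) $ a) *s row a M)"
      by (simp add: vconj_def conj_transpose_def vec_eq_iff row_def matrix_vector_mult_def[of "vec_lambda _"]
          conjugate_sum conjugate_mult mult.commute)
    finally have "w i = inverse s *s (\<Sum>a\<in>UNIV. conjugate ((M *v v i) $ a) *s row a M)"
      using i(2) by (metis vector_smult_assoc left_inverse vector_smult_lid)
    also have "\<dots> \<in> vec.span (rows M)"
      by (intro vec.span_sum vec.span_scale vec.span_base) (auto simp: rows_def)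
    finally show ?thesis .
  qed
  then have "card (w ` J) \<le> vec.dim (vec.span (rows M))"
    using w by (intro vec.independent_card_le_dim orthonormal_independent) (auto simp: J_def)
  then show ?thesis
    using orthonormal_inj_on[OF w] by (simp add: card_image row_rank_def_gen J_def)
qed

text \<open>Only nonzero singular values contribute to the singular value decomposition. There are
  at most \<open>rank M\<close> of them and their squares add up to the squared Frobenius norm, so
  Cauchy--Schwarz bounds their sum.\<close>

lemma dyadic_decomposition_rank:
  fixes M :: "'a::real_or_complex^'n^'m"
  obtains K :: "nat set" and b c where "finite K"
    "\<And>i j. M $ i $ j = (\<Sum>l\<in>K. b l $ i * c l $ j)"
    "(\<Sum>l\<in>K. norm (b l) * norm (c l)) \<le> sqrt (real (rank M)) * norm M"
proof -
  obtain v where v: "singular_basis M v" by (rule singular_basis_exists)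
  note on = singular_basis_orthonormal[OF v]
  define K where "K = {i \<in> {..<CARD('n)}. norm (M *v v i) \<noteq> 0}"
  have "M $ i $ j = (\<Sum>l\<in>K. (M *v v l) $ i * vconj (v l) $ j)" for i j
    unfolding orthonormal_dyadic_expansion[OF on, of M]
    by (intro sum.mono_neutral_cong_right) (auto simp: K_def vconj_def)
  moreover have "(\<Sum>l\<in>K. norm (M *v v l) * norm (vconj (v l))) \<le> sqrt (real (rank M)) * norm M"
  proof -
    have "(\<Sum>l\<in>K. norm (M *v v l) * norm (vconj (v l))) = (\<Sum>l\<in>K. norm (M *v v l))"
      using on by (intro sum.cong) (auto simp: K_def orthonormal_def)
    also have "\<dots> \<le> sqrt ((\<Sum>l\<in>K. (norm (M *v v l))\<^sup>2) * real (card K))"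
      by (intro real_le_rsqrt sum_squared_le_sum_of_squares)
    also have "(\<Sum>l\<in>K. (norm (M *v v l))\<^sup>2) = (norm M)\<^sup>2"
      unfolding norm_square_eq_sum_orthonormal[OF on, of M]
      by (intro sum.mono_neutral_left) (auto simp: K_def)
    also have "sqrt ((norm M)\<^sup>2 * real (card K)) = sqrt (real (card K)) * norm M"
      by (simp add: real_sqrt_mult)
    also have "\<dots> \<le> sqrt (real (rank M)) * norm M"
      using card_nonzero_singular_le_rank[OF v] by (intro mult_right_mono) (auto simp: K_def)
    finally show ?thesis .
  qed
  ultimately show ?thesis
    using that[of K "\<lambda>l. M *v v l" "\<lambda>l. vconj (v l)"] by (simp add: K_def)
qed

lemma norm_transpose: "norm (transpose M) = norm (M :: 'a::real_normed_vector^'n^'m)"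
  unfolding norm_vec_def L2_set_def transpose_def
  by (simp add: sum_nonneg sum.swap[of _ "UNIV :: 'm set"])

text \<open>Transposing keeps the norm and swaps the two factors of each dyad. With both ranks in
  the bound, each can be estimated by its own flattening of the tensor.\<close>

lemma dyadic_decomposition:
  fixes M :: "'a::real_or_complex^'n^'m"
  obtains K :: "nat set" and b c where "finite K"
    "\<And>i j. M $ i $ j = (\<Sum>l\<in>K. b l $ i * c l $ j)"
    "(\<Sum>l\<in>K. norm (b l) * norm (c l)) \<le> sqrt (real (min (rank M) (rank (transpose M)))) * norm M"
proof (cases "rank M \<le> rank (transpose M)")
  case True
  show ?thesis
  proof (rule dyadic_decomposition_rank[of M])
    fix K :: "nat set" and b c
    assume "finite K" "\<And>i j. M $ i $ j = (\<Sum>l\<in>K. b l $ i * c l $ j)"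
      "(\<Sum>l\<in>K. norm (b l) * norm (c l)) \<le> sqrt (real (rank M)) * norm M"
    then show ?thesis using that True by (simp add: min_absorb1)
  qed
next
  case False
  obtain K :: "nat set" and b c where K: "finite K"
    "\<And>i j. transpose M $ i $ j = (\<Sum>l\<in>K. b l $ i * c l $ j)"
    "(\<Sum>l\<in>K. norm (b l) * norm (c l)) \<le> sqrt (real (rank (transpose M))) * norm (transpose M)"
    using dyadic_decomposition_rank[of "transpose M"] by blast
  have "M $ i $ j = (\<Sum>l\<in>K. c l $ i * b l $ j)" for i j
    using K(2)[of j i] by (simp add: transpose_def mult.commute)
  moreover have "(\<Sum>l\<in>K. norm (c l) * norm (b l)) \<le> sqrt (real (min (rank M) (rank (transpose M)))) * norm M"
    using K(3) False by (simp add: norm_transpose mult.commute min_def)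
  ultimately show ?thesis using that K(1) by blast
qed

section \<open>Flattenings and contractions\<close>

lemma rank_le_of_rows:
  fixes M :: "'a::field^'n^'m" and N :: "'a^'k^'m"
  assumes "\<And>j. M $ j = C *v N $ j"
  shows "rank M \<le> rank N"
proof -
  have "rows M = (*v) C ` rows N"
    using assms by (auto simp: rows_def row_def vec_nth_inverse image_def)
  then show ?thesis
    unfolding row_rank_def_gen by (simp add: vec.dim_image_le)
qed

text \<open>The columns of \<open>M\<close> are chosen among those of \<open>N\<close>;
  \<open>C\<close> reads off coordinate \<open>f c\<close> of a row.\<close>

lemma rank_le_of_column_map:
  fixes M :: "'a::field^'n^'m" and N :: "'a^'k^'m"
  assumes "\<And>j c. M $ j $ c = N $ j $ f c"
  shows "rank M \<le> rank N"
  by (rule rank_le_of_rows[where C = "\<chi> c d. if d = f c then 1 else 0"])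
    (simp add: vec_eq_iff matrix_vector_mult_def assms if_distrib[of "\<lambda>x. x * _"] cong: if_cong)

lemma sum_UNIV_pair:
  "(\<Sum>p\<in>UNIV. f p) = (\<Sum>i\<in>UNIV. \<Sum>j\<in>UNIV. f (i :: 'i::finite, j :: 'j::finite))"
  by (simp add: sum.cartesian_product)

text \<open>The conjugate on \<open>u\<close> makes this the entrywise conjugate of
  \<open>M^* u\<close> for \<open>M = flat1 A\<close>, read as a matrix. For \<open>u = M v\<close>
  with a right singular vector \<open>v\<close> it is thus a multiple of the conjugate of
  \<open>v\<close>.\<close>

definition contract :: "'a::real_or_complex^'m \<Rightarrow> 'a^'p^'n^'m \<Rightarrow> 'a^'p^'n" where
  "contract u A = (\<chi> j k. \<Sum>i\<in>UNIV. conjugate (u $ i) * A $ i $ j $ k)"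

text \<open>Each row of the contraction is the same linear function of the corresponding row of
  \<open>flat2 A\<close>: the matrix \<open>C\<close> sums out the first-mode index. The columns
  relate to \<open>flat3 A\<close> in the same way.\<close>

lemma rank_contract_le: "rank (contract u A) \<le> rank (flat2 A)"
  by (rule rank_le_of_rows[where
        C = "\<chi> k ik. if snd ik = k then conjugate (u $ fst ik) else 0"])
    (simp add: vec_eq_iff matrix_vector_mult_def contract_def flat2_def sum_UNIV_pair
      if_distrib[of "\<lambda>x. x * _"] cong: if_cong)

lemma rank_transpose_contract_le: "rank (transpose (contract u A)) \<le> rank (flat3 A)"
  by (rule rank_le_of_rows[where
        C = "\<chi> j ij. if snd ij = j then conjugate (u $ fst ij) else 0"])
    (simp add: vec_eq_iff matrix_vector_mult_def contract_def flat3_def transpose_def sum_UNIV_pair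
      if_distrib[of "\<lambda>x. x * _"] cong: if_cong)

lemma contract_eq:
  "contract u A $ j $ k = conjugate ((conj_transpose (flat1 A) *v u) $ (j, k))"
  by (simp add: contract_def conj_transpose_def flat1_def matrix_vector_mult_def
      conjugate_sum conjugate_mult mult.commute)

lemma norm_contract: "norm (contract u A) = norm (conj_transpose (flat1 A) *v u)"
proof -
  have "(norm (contract u A))\<^sup>2 = (norm (conj_transpose (flat1 A) *v u))\<^sup>2"
    unfolding norm_vec_square contract_eq norm_conjugate sum_UNIV_pair ..
  then show ?thesis by (simp add: power2_eq_iff_nonneg)
qed

text \<open>Indexed like the columns of \<open>flat1\<close>, so that \<open>outer3 x y z\<close>
  flattens to the dyad of \<open>x\<close> and \<open>kron y z\<close>.\<close>

definition kron :: "'a::real_or_complex^'n \<Rightarrow> 'a^'p \<Rightarrow> 'a^('n \<times> 'p)" where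
  "kron y z = (\<chi> jk. y $ fst jk * z $ snd jk)"

lemma norm_kron: "norm (kron y z) = norm y * norm z"
proof -
  have "(norm (kron y z))\<^sup>2 = (norm y * norm z)\<^sup>2"
    unfolding power_mult_distrib norm_vec_square sum_UNIV_pair
    by (simp add: kron_def norm_mult power_mult_distrib sum_product)
  then show ?thesis by (simp add: power2_eq_iff_nonneg)
qed

section \<open>The tensor norms\<close>

lemma tensor_inner_outer3:
  "tensor_inner A (outer3 x y z) = hinner (flat1 A *v vconj (kron y z)) x"
  by (simp add: tensor_inner_def outer3_def hinner_def matrix_vector_mult_def flat1_def vconj_def
      kron_def sum_UNIV_pair conjugate_mult sum_distrib_right sum_distrib_left mult_ac)

lemma norm_tensor_inner_outer3_le:
  "norm (tensor_inner A (outer3 x y z))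
    \<le> matrix_spectral_norm (flat1 A) * (norm x * norm y * norm z)"
proof -
  have "norm (tensor_inner A (outer3 x y z))
      \<le> norm (flat1 A *v vconj (kron y z)) * norm x"
    unfolding tensor_inner_outer3 by (rule norm_hinner_le)
  also have "\<dots> \<le> matrix_spectral_norm (flat1 A) * norm (vconj (kron y z)) * norm x"
    by (intro mult_right_mono norm_mult_vec_le) simp
  finally show ?thesis by (simp add: norm_kron mult_ac)
qed

lemma tensor_quotient_le:
  "norm (tensor_inner A (outer3 x y z)) / (norm x * norm y * norm z)
    \<le> matrix_spectral_norm (flat1 A)"
  using norm_tensor_inner_outer3_le[of A x y z] matrix_spectral_norm_nonneg[of "flat1 A"]
  by (cases "norm x * norm y * norm z = 0") (auto simp: divide_simps)

lemma exists_nonzero_vec: "\<exists>x :: 'a::zero_neq_one^'n. x \<noteq> 0"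
  by (rule exI[of _ "axis undefined 1"]) (simp add: axis_eq_0_iff)

lemma tensor_spectral_norm_leI:
  fixes A :: "'a::real_or_complex^'p^'n^'m"
  assumes "\<And>x y z. norm (tensor_inner A (outer3 x y z)) \<le> B * (norm x * norm y * norm z)"
  shows "tensor_spectral_norm A \<le> B"
  unfolding tensor_spectral_norm_def
proof (rule cSup_least)
  show "{norm (tensor_inner A (outer3 x y z)) / (norm x * norm y * norm z) | x y z.
      x \<noteq> 0 \<and> y \<noteq> 0 \<and> z \<noteq> 0} \<noteq> {}"
    using exists_nonzero_vec[where 'a='a and 'n='m] exists_nonzero_vec[where 'a='a and 'n='n]
      exists_nonzero_vec[where 'a='a and 'n='p] by blast
next
  fix t assume "t \<in> {norm (tensor_inner A (outer3 x y z)) / (norm x * norm y * norm z) | x y z.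
      x \<noteq> 0 \<and> y \<noteq> 0 \<and> z \<noteq> 0}"
  then show "t \<le> B"
    using assms by (auto simp: pos_divide_le_eq)
qed

lemma tensor_spectral_norm_le_flat1: "tensor_spectral_norm A \<le> matrix_spectral_norm (flat1 A)"
  by (intro tensor_spectral_norm_leI norm_tensor_inner_outer3_le)

lemma tensor_quotient_le_spectral_norm:
  assumes "x \<noteq> 0" "y \<noteq> 0" "z \<noteq> 0"
  shows "norm (tensor_inner A (outer3 x y z)) / (norm x * norm y * norm z)
    \<le> tensor_spectral_norm A"
  unfolding tensor_spectral_norm_def
proof (rule cSup_upper)
  show "bdd_above {norm (tensor_inner A (outer3 x y z)) / (norm x * norm y * norm z) | x y z.
      x \<noteq> 0 \<and> y \<noteq> 0 \<and> z \<noteq> 0}"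
    by (rule bdd_aboveI[of _ "matrix_spectral_norm (flat1 A)"]) (use tensor_quotient_le in blast)
qed (use assms in blast)

lemma tensor_spectral_norm_nonneg:
  fixes A :: "'a::real_or_complex^'p^'n^'m"
  shows "0 \<le> tensor_spectral_norm A"
proof -
  obtain x :: "'a^'m" and y :: "'a^'n" and z :: "'a^'p" where "x \<noteq> 0" "y \<noteq> 0" "z \<noteq> 0"
    using exists_nonzero_vec[where 'a='a and 'n='m] exists_nonzero_vec[where 'a='a and 'n='n]
      exists_nonzero_vec[where 'a='a and 'n='p] by blast
  then have "norm (tensor_inner A (outer3 x y z)) / (norm x * norm y * norm z) \<le> tensor_spectral_norm A"
    by (rule tensor_quotient_le_spectral_norm)
  then show ?thesis
    by (rule order_trans[rotated]) simp
qed

lemma norm_tensor_inner_le_spectral_norm: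
  "norm (tensor_inner A (outer3 x y z)) \<le> tensor_spectral_norm A * (norm x * norm y * norm z)"
proof (cases "x = 0 \<or> y = 0 \<or> z = 0")
  case True
  then show ?thesis using norm_tensor_inner_outer3_le[of A x y z] by auto
next
  case False
  then show ?thesis
    using tensor_quotient_le_spectral_norm[of x y z A] by (simp add: divide_simps)
qed

lemma tensor_inner_sum_right: "tensor_inner A (\<Sum>l\<in>K. B l) = (\<Sum>l\<in>K. tensor_inner A (B l))"
  by (induction K rule: infinite_finite_induct)
    (simp_all add: tensor_inner_def conjugate_add distrib_left sum.distrib)

text \<open>Pairing \<open>A\<close> with \<open>u \<otimes> C\<close> first contracts
  \<open>A\<close> with \<open>u\<close>, giving \<open>C\<close>, and then pairs \<open>C\<close>
  with itself.\<close>

lemma tensor_inner_contract: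
  "tensor_inner A (\<chi> i j k. u $ i * contract u A $ j $ k) = of_real ((norm (contract u A))\<^sup>2)"
proof -
  let ?C = "contract u A"
  have "tensor_inner A (\<chi> i j k. u $ i * ?C $ j $ k)
      = (\<Sum>i\<in>UNIV. \<Sum>jk\<in>UNIV. conjugate (u $ i) * A $ i $ fst jk $ snd jk * conjugate (?C $ fst jk $ snd jk))"
    by (simp add: tensor_inner_def sum_UNIV_pair conjugate_mult mult_ac)
  also have "\<dots> = (\<Sum>jk\<in>UNIV. ?C $ fst jk $ snd jk * conjugate (?C $ fst jk $ snd jk))"
    by (subst sum.swap) (simp add: contract_def sum_distrib_right)
  also have "\<dots> = of_real ((norm ?C)\<^sup>2)"
    by (simp add: sum_UNIV_pair mult_conjugate_of_real norm_vec_square)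
  finally show ?thesis .
qed

text \<open>Let \<open>u\<close> be the image of a top singular vector and \<open>C\<close> the
  contraction of \<open>A\<close> with \<open>u\<close>. Testing \<open>A\<close> against
  \<open>u \<otimes> C\<close> gives the squared norm of \<open>C\<close>; splitting
  \<open>C\<close> into dyads bounds the same number by the tensor spectral norm at the price of the
  rank factor.\<close>

lemma flat1_spectral_norm_le:
  "matrix_spectral_norm (flat1 A)
    \<le> sqrt (real (min (rank (flat2 A)) (rank (flat3 A)))) * tensor_spectral_norm A"
proof -
  let ?r = "sqrt (real (min (rank (flat2 A)) (rank (flat3 A))))"
  define \<sigma> where "\<sigma> = matrix_spectral_norm (flat1 A)"
  obtain x where x: "norm x = 1" "norm (flat1 A *v x) = \<sigma>"
    "conj_transpose (flat1 A) *v (flat1 A *v x) = of_real (\<sigma>\<^sup>2) *s x"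
    unfolding \<sigma>_def by (rule matrix_spectral_norm_attained)
  define u where "u = flat1 A *v x"
  define C where "C = contract u A"
  have C: "norm C = \<sigma>\<^sup>2"
    unfolding C_def norm_contract u_def x(3) by (simp add: x(1) norm_power)
  obtain K :: "nat set" and b c where K: "finite K"
    "\<And>i j. C $ i $ j = (\<Sum>l\<in>K. b l $ i * c l $ j)"
    "(\<Sum>l\<in>K. norm (b l) * norm (c l)) \<le> sqrt (real (min (rank C) (rank (transpose C)))) * norm C"
    using dyadic_decomposition[of C] by blast
  have "(\<chi> i j k. u $ i * C $ j $ k) = (\<Sum>l\<in>K. outer3 u (b l) (c l))"
    by (simp add: vec_eq_iff K(2) outer3_def sum_distrib_left mult.assoc)
  then have "of_real ((norm C)\<^sup>2) = (\<Sum>l\<in>K. tensor_inner A (outer3 u (b l) (c l)))"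
    using tensor_inner_contract[of A u] by (simp add: C_def tensor_inner_sum_right)
  then have "norm (of_real ((norm C)\<^sup>2) :: 'a) \<le> (\<Sum>l\<in>K. norm (tensor_inner A (outer3 u (b l) (c l))))"
    by (simp only: norm_sum)
  also have "\<dots> \<le> (\<Sum>l\<in>K. tensor_spectral_norm A * (norm u * norm (b l) * norm (c l)))"
    by (intro sum_mono norm_tensor_inner_le_spectral_norm)
  also have "\<dots> = tensor_spectral_norm A * norm u * (\<Sum>l\<in>K. norm (b l) * norm (c l))"
    by (simp add: sum_distrib_left mult.assoc)
  also have "\<dots> \<le> tensor_spectral_norm A * norm u * (?r * norm C)"
  proof (intro mult_left_mono order_trans[OF K(3)] mult_right_mono)
    show "sqrt (real (min (rank C) (rank (transpose C)))) \<le> ?r"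
      unfolding C_def using rank_contract_le[of u A] rank_transpose_contract_le[of u A] by auto
  qed (simp_all add: tensor_spectral_norm_nonneg)
  finally have "(norm C)\<^sup>2 \<le> tensor_spectral_norm A * \<sigma> * (?r * norm C)"
    by (simp add: u_def x(2) norm_power)
  \<comment> \<open>With \<open>norm u = \<sigma>\<close> and
    \<open>norm C = \<sigma>\<^sup>2\<close> the estimate compares fourth with third powers of
    \<open>\<sigma>\<close>; the common factor cancels unless \<open>\<sigma> = 0\<close>.\<close>
  then have *: "\<sigma> * \<sigma> ^ 3 \<le> (?r * tensor_spectral_norm A) * \<sigma> ^ 3"
    unfolding C by (simp add: power2_eq_square power3_eq_cube mult_ac)
  show ?thesis
  proof (cases "\<sigma> = 0")
    case True
    then show ?thesis using tensor_spectral_norm_nonneg[of A] by (simp add: \<sigma>_def)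
  next
    case False
    then have "0 < \<sigma>" using x(2) norm_ge_zero[of "flat1 A *v x"] by linarith
    then show ?thesis
      using * unfolding \<sigma>_def[symmetric] by (simp add: mult_le_cancel_right)
  qed
qed

section \<open>Nuclear norm of the tensor and of its first flattening\<close>

lemma tensor_nuclear_norm_le:
  assumes "finite I" "A = (\<Sum>i\<in>I. outer3 (x i) (y i) (z i))"
  shows "tensor_nuclear_norm A \<le> (\<Sum>i\<in>I. norm (x i) * norm (y i) * norm (z i))"
proof -
  obtain h where h: "bij_betw h {..<card I} I"
    using ex_bij_betw_nat_finite[OF assms(1)] by (auto simp: lessThan_atLeast0)
  have "A = (\<Sum>i<card I. outer3 (x (h i)) (y (h i)) (z (h i)))"
    unfolding assms(2) by (rule sum.reindex_bij_betw[OF h, symmetric])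
  moreover have "(\<Sum>i\<in>I. norm (x i) * norm (y i) * norm (z i))
      = (\<Sum>i<card I. norm (x (h i)) * norm (y (h i)) * norm (z (h i)))"
    by (rule sum.reindex_bij_betw[OF h, symmetric])
  moreover have "bdd_below {\<Sum>i<r. norm (x i) * norm (y i) * norm (z i) | (r::nat) x y z.
      A = (\<Sum>i<r. outer3 (x i) (y i) (z i))}"
    by (rule bdd_belowI[of _ 0]) (auto intro!: sum_nonneg)
  ultimately show ?thesis
    unfolding tensor_nuclear_norm_def
    by (intro cInf_lower) (auto intro!: exI[of _ "card I"] exI[of _ "\<lambda>i. x (h i)"]
        exI[of _ "\<lambda>i. y (h i)"] exI[of _ "\<lambda>i. z (h i)"])
qed

lemma le_tensor_nuclear_norm:
  fixes A :: "'a::real_or_complex^'p^'n^'m"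
  assumes "\<And>(r::nat) x y z. A = (\<Sum>i<r. outer3 (x i) (y i) (z i))
    \<Longrightarrow> B \<le> (\<Sum>i<r. norm (x i) * norm (y i) * norm (z i))"
  shows "B \<le> tensor_nuclear_norm A"
  unfolding tensor_nuclear_norm_def
proof (rule cInf_greatest)
  obtain h where h: "bij_betw h {..<card (UNIV :: ('m \<times> 'n \<times> 'p) set)} (UNIV :: ('m \<times> 'n \<times> 'p) set)"
    using ex_bij_betw_nat_finite[OF finite] unfolding lessThan_atLeast0 by blast
  \<comment> \<open>The entrywise decomposition into scaled unit tensors shows that the infimum is
    taken over a nonempty set.\<close>
  define T :: "'m \<times> 'n \<times> 'p \<Rightarrow> 'a^'p^'n^'m" where
    "T q = outer3 (axis (fst q) (A $ fst q $ fst (snd q) $ snd (snd q)))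
      (axis (fst (snd q)) 1) (axis (snd (snd q)) 1)" for q
  have "A = (\<Sum>q\<in>UNIV. T q)"
    by (simp add: vec_eq_iff T_def sum_UNIV_pair outer3_def axis_def
        if_distrib[of "\<lambda>x. x * _"] if_distrib[of "\<lambda>x. _ * x"] cong: if_cong)
  also have "\<dots> = (\<Sum>l<card (UNIV :: ('m \<times> 'n \<times> 'p) set). T (h l))"
    by (rule sum.reindex_bij_betw[OF h, symmetric])
  finally obtain r :: nat and x y z where "A = (\<Sum>i<r. outer3 (x i) (y i) (z i))"
    unfolding T_def by (rule that)
  then show "{\<Sum>i<r. norm (x i) * norm (y i) * norm (z i) | (r::nat) x y z.
      A = (\<Sum>i<r. outer3 (x i) (y i) (z i))} \<noteq> {}"
    by blast
qed (use assms in blast)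

text \<open>Each nonzero singular value is the pairing of \<open>M v_i\<close> with a left singular
  vector \<open>u_i\<close>. Inserting the given decomposition and summing over \<open>i\<close>,
  Cauchy--Schwarz and Bessel for both orthonormal families leave the product of the norms of
  \<open>x l\<close> and \<open>w l\<close> for each term.\<close>

lemma flat1_nuclear_norm_le_decomposition:
  fixes A :: "'a::real_or_complex^'p^'n^'m" and r :: nat
  assumes A: "A = (\<Sum>l<r. outer3 (x l) (y l) (z l))"
  shows "matrix_nuclear_norm (flat1 A) \<le> (\<Sum>l<r. norm (x l) * norm (y l) * norm (z l))"
proof -
  let ?M = "flat1 A"
  obtain v where v: "singular_basis ?M v" by (rule singular_basis_exists)
  note on = singular_basis_orthonormal[OF v]
  define s where "s i = norm (?M *v v i)" for i
  define J where "J = {i \<in> {..<CARD('n \<times> 'p)}. s i \<noteq> 0}"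
  \<comment> \<open>The left singular vectors, of norm one only for indices in
    \<open>J\<close>.\<close>
  define u where "u i = of_real (1 / s i) *s (?M *v v i)" for i
  define w where "w l = vconj (kron (y l) (z l))" for l
  have J: "finite J" "J \<subseteq> {..<CARD('n \<times> 'p)}" by (auto simp: J_def)
  have v': "orthonormal J v" using on J(2) by (rule orthonormal_subset)
  have s0: "s i \<noteq> 0" if "i \<in> J" for i using that by (simp add: J_def)
  have u: "orthonormal J u"
    unfolding orthonormal_def
  proof (intro conjI ballI impI)
    fix i assume "i \<in> J"
    then show "norm (u i) = 1"
      using s0[of i] by (simp add: u_def norm_divide) (simp add: s_def)
  next
    fix i j assume "i \<in> J" "j \<in> J" "i \<noteq> j"
    then show "hinner (u i) (u j) = 0"
      using v J(2) by (auto simp: u_def singular_basis_def subset_eq)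
  qed
  have entry: "?M $ a $ jk = (\<Sum>l<r. x l $ a * conjugate (w l $ jk))" for a jk
    by (subst A) (simp add: flat1_def outer3_def w_def vconj_def kron_def mult.assoc)
  \<comment> \<open>The flattened decomposition is a sum of dyads \<open>x_l w_l^*\<close>, so
    applying it to \<open>v i\<close> combines the \<open>x l\<close>.\<close>
  have Mv: "?M *v v i = (\<Sum>l<r. hinner (v i) (w l) *s x l)" for i
  proof (rule vec_eq_iff[THEN iffD2], rule allI)
    fix a
    have "(?M *v v i) $ a = (\<Sum>jk\<in>UNIV. \<Sum>l<r. x l $ a * conjugate (w l $ jk) * v i $ jk)"
      by (simp add: matrix_vector_mult_def entry sum_distrib_right)
    also have "\<dots> = (\<Sum>l<r. \<Sum>jk\<in>UNIV. x l $ a * conjugate (w l $ jk) * v i $ jk)"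
      by (rule sum.swap)
    also have "\<dots> = (\<Sum>l<r. hinner (v i) (w l) *s x l) $ a"
      by (simp add: hinner_def sum_distrib_left mult_ac)
    finally show "(?M *v v i) $ a = (\<Sum>l<r. hinner (v i) (w l) *s x l) $ a" .
  qed
  have s_le: "s i \<le> (\<Sum>l<r. norm (hinner (w l) (v i)) * norm (hinner (x l) (u i)))" if i: "i \<in> J" for i
  proof -
    have "hinner (?M *v v i) (u i) = of_real (1 / s i) * of_real ((s i)\<^sup>2)"
      unfolding u_def hinner_smult_right conjugate_of_real hinner_self s_def ..
    also have "\<dots> = of_real (s i)"
      using s0[OF i] by (simp add: power2_eq_square)
    finally have "s i = norm (hinner (?M *v v i) (u i))"
      by (simp add: s_def)
    also have "\<dots> \<le> (\<Sum>l<r. norm (hinner (v i) (w l) * hinner (x l) (u i)))"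
      unfolding Mv hinner_sum_left hinner_smult_left by (rule norm_sum)
    also have "\<dots> = (\<Sum>l<r. norm (hinner (w l) (v i)) * norm (hinner (x l) (u i)))"
      by (simp add: norm_mult hinner_commute[of "v i"])
    finally show ?thesis .
  qed
  have "matrix_nuclear_norm ?M = (\<Sum>i\<in>J. s i)"
    unfolding matrix_nuclear_norm_eq[OF v] s_def[symmetric]
    by (intro sum.mono_neutral_right) (auto simp: J_def)
  also have "\<dots> \<le> (\<Sum>i\<in>J. \<Sum>l<r. norm (hinner (w l) (v i)) * norm (hinner (x l) (u i)))"
    by (intro sum_mono s_le)
  also have "\<dots> = (\<Sum>l<r. \<Sum>i\<in>J. norm (hinner (w l) (v i)) * norm (hinner (x l) (u i)))"
    by (rule sum.swap)
  also have "\<dots> \<le> (\<Sum>l<r. norm (w l) * norm (x l))"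
  proof (rule sum_mono)
    fix l
    have "(\<Sum>i\<in>J. norm (hinner (w l) (v i)) * norm (hinner (x l) (u i)))
        \<le> L2_set (\<lambda>i. norm (hinner (w l) (v i))) J * L2_set (\<lambda>i. norm (hinner (x l) (u i))) J"
      using L2_set_mult_ineq[of "\<lambda>i. norm (hinner (w l) (v i))" "\<lambda>i. norm (hinner (x l) (u i))" J]
      by simp
    also have "\<dots> \<le> norm (w l) * norm (x l)"
      unfolding L2_set_def
      by (intro mult_mono real_le_lsqrt bessel v' u J) (simp_all add: sum_nonneg)
    finally show "(\<Sum>i\<in>J. norm (hinner (w l) (v i)) * norm (hinner (x l) (u i))) \<le> norm (w l) * norm (x l)" .
  qed
  also have "\<dots> = (\<Sum>l<r. norm (x l) * norm (y l) * norm (z l))"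
    by (simp add: w_def norm_kron mult_ac)
  finally show ?thesis .
qed

lemma flat1_nuclear_norm_le: "matrix_nuclear_norm (flat1 A) \<le> tensor_nuclear_norm A"
  by (intro le_tensor_nuclear_norm flat1_nuclear_norm_le_decomposition)

text \<open>In the singular value decomposition of the flattening, each conjugated right singular
  vector is a contraction \<open>C i\<close> of the tensor divided by \<open>(s i)\<^sup>2\<close>.
  Splitting \<open>C i\<close> into dyads costs the rank factor and produces a decomposition of
  \<open>A\<close>.\<close>

lemma tensor_nuclear_norm_le_flat1:
  fixes A :: "'a::real_or_complex^'p^'n^'m"
  shows "tensor_nuclear_norm A
    \<le> sqrt (real (min (rank (flat2 A)) (rank (flat3 A)))) * matrix_nuclear_norm (flat1 A)"
proof -
  let ?M = "flat1 A" and ?r = "sqrt (real (min (rank (flat2 A)) (rank (flat3 A))))"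
  obtain v where v: "singular_basis ?M v" by (rule singular_basis_exists)
  note on = singular_basis_orthonormal[OF v]
  define s where "s i = norm (?M *v v i)" for i
  define J where "J = {i \<in> {..<CARD('n \<times> 'p)}. s i \<noteq> 0}"
  define C where "C i = contract (?M *v v i) A" for i
  have J: "finite J" "\<And>i. i \<in> J \<Longrightarrow> i < CARD('n \<times> 'p)" "\<And>i. i \<in> J \<Longrightarrow> s i \<noteq> 0"
    by (auto simp: J_def)
  have C_entry: "C i $ j $ k = of_real ((s i)\<^sup>2) * conjugate (v i $ (j, k))" if "i \<in> J" for i j k
    unfolding C_def contract_eq singular_basis_eigenvector[OF v J(2)[OF that]] s_def
    by (simp add: conjugate_mult del: of_real_power)
  have C_norm: "norm (C i) = (s i)\<^sup>2" if "i \<in> J" for i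
    unfolding C_def norm_contract singular_basis_eigenvector[OF v J(2)[OF that]] s_def
    using on J(2)[OF that] by (simp add: orthonormal_def norm_power)
  define P where "P i K b c \<longleftrightarrow> finite K \<and> (\<forall>j k. C i $ j $ k = (\<Sum>l\<in>K. b l $ j * c l $ k)) \<and>
      (\<Sum>l\<in>K. norm (b l) * norm (c l)) \<le> ?r * norm (C i)"
    for i and K :: "nat set" and b c
  have "\<exists>K b c. P i K b c" for i
  proof -
    obtain K :: "nat set" and b c where K: "finite K"
      "\<And>j k. C i $ j $ k = (\<Sum>l\<in>K. b l $ j * c l $ k)"
      "(\<Sum>l\<in>K. norm (b l) * norm (c l))
        \<le> sqrt (real (min (rank (C i)) (rank (transpose (C i))))) * norm (C i)"
      using dyadic_decomposition[of "C i"] by blast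
    have "sqrt (real (min (rank (C i)) (rank (transpose (C i))))) \<le> ?r"
      unfolding C_def using rank_contract_le[of _ A] rank_transpose_contract_le[of _ A]
      by (intro real_sqrt_le_mono of_nat_mono min.mono)
    then have "(\<Sum>l\<in>K. norm (b l) * norm (c l)) \<le> ?r * norm (C i)"
      by (intro order_trans[OF K(3)] mult_right_mono) auto
    then have "P i K b c" using K(1,2) by (simp add: P_def)
    then show ?thesis by blast
  qed
  then obtain K b c where "\<And>i. P i (K i) (b i) (c i)"
    by metis
  then have K: "\<And>i. finite (K i)"
    "\<And>i j k. C i $ j $ k = (\<Sum>l\<in>K i. b i l $ j * c i l $ k)"
    "\<And>i. (\<Sum>l\<in>K i. norm (b i l) * norm (c i l)) \<le> ?r * norm (C i)"
    by (simp_all add: P_def)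
  \<comment> \<open>The factor \<open>1 / (s i)\<^sup>2\<close> undoes the scaling in
    \<open>C_entry\<close>. The total cost at \<open>i\<close> is then \<open>1 / s i\<close> times
    \<open>?r * (s i)\<^sup>2\<close>, that is \<open>?r * s i\<close>.\<close>
  define x where "x i = of_real (1 / (s i)\<^sup>2) *s (?M *v v i)" for i
  have x_norm: "norm (x i) = 1 / s i" if "i \<in> J" for i
    using J(3)[OF that] unfolding x_def
    by (simp add: norm_divide norm_power) (simp add: s_def power2_eq_square)
  have "A $ a $ j $ k = (\<Sum>i\<in>J. \<Sum>l\<in>K i. x i $ a * b i l $ j * c i l $ k)" for a j k
  proof -
    have "A $ a $ j $ k = ?M $ a $ (j, k)"
      by (simp add: flat1_def)
    also have "\<dots> = (\<Sum>i\<in>J. (?M *v v i) $ a * conjugate (v i $ (j, k)))"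
      unfolding orthonormal_dyadic_expansion[OF on, of ?M]
      by (intro sum.mono_neutral_cong_right) (auto simp: J_def s_def)
    also have "\<dots> = (\<Sum>i\<in>J. x i $ a * C i $ j $ k)"
      using J(3) by (intro sum.cong) (simp_all add: C_entry x_def)
    also have "\<dots> = (\<Sum>i\<in>J. \<Sum>l\<in>K i. x i $ a * b i l $ j * c i l $ k)"
      by (simp add: K(2) sum_distrib_left mult.assoc)
    finally show ?thesis .
  qed
  then have "A = (\<Sum>i\<in>J. \<Sum>l\<in>K i. outer3 (x i) (b i l) (c i l))"
    by (simp add: vec_eq_iff outer3_def)
  also have "\<dots> = (\<Sum>q\<in>Sigma J K. outer3 (x (fst q)) (b (fst q) (snd q)) (c (fst q) (snd q)))"
    using J(1) K(1) by (simp add: sum.Sigma case_prod_unfold)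
  finally have "tensor_nuclear_norm A
      \<le> (\<Sum>q\<in>Sigma J K. norm (x (fst q)) * norm (b (fst q) (snd q)) * norm (c (fst q) (snd q)))"
    by (intro tensor_nuclear_norm_le) (use J(1) K(1) in auto)
  also have "\<dots> = (\<Sum>i\<in>J. norm (x i) * (\<Sum>l\<in>K i. norm (b i l) * norm (c i l)))"
    using J(1) K(1) by (simp add: sum.Sigma case_prod_unfold sum_distrib_left mult.assoc)
  also have "\<dots> \<le> (\<Sum>i\<in>J. norm (x i) * (?r * norm (C i)))"
    by (intro sum_mono mult_left_mono K(3)) simp
  also have "\<dots> = (\<Sum>i\<in>J. ?r * s i)"
    using J(3) by (intro sum.cong) (simp_all add: x_norm C_norm power2_eq_square)
  also have "\<dots> = ?r * (\<Sum>i\<in>J. s i)"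
    by (simp add: sum_distrib_left)
  also have "(\<Sum>i\<in>J. s i) = matrix_nuclear_norm ?M"
    unfolding matrix_nuclear_norm_eq[OF v] s_def[symmetric]
    by (intro sum.mono_neutral_left) (auto simp: J_def)
  finally show ?thesis .
qed

section \<open>Permutation of the modes\<close>

text \<open>The chosen mode moves to the front and the other two keep their order, so
  \<open>flat1\<close> of the permuted tensor is literally \<open>flat2 A\<close> or, for
  \<open>perm3\<close>, \<open>flat3 A\<close>.\<close>

definition perm2 :: "'a^'p^'n^'m \<Rightarrow> 'a^'p^'m^'n" where
  "perm2 A = (\<chi> j i k. A $ i $ j $ k)"

definition perm3 :: "'a^'p^'n^'m \<Rightarrow> 'a^'n^'m^'p" where
  "perm3 A = (\<chi> k i j. A $ i $ j $ k)"

lemma flat1_perm2: "flat1 (perm2 A) = flat2 A"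
  and flat2_perm2: "flat2 (perm2 A) = flat1 A"
  and flat1_perm3: "flat1 (perm3 A) = flat3 A"
  by (simp_all add: perm2_def perm3_def flat1_def flat2_def flat3_def)

text \<open>Here the columns are indexed by swapped pairs. One inequality suffices, as
  \<open>flattening_bounds\<close> asks only for upper bounds of the ranks.\<close>

lemma rank_flat3_perm2: "rank (flat3 (perm2 A)) \<le> rank (flat3 A)"
  and rank_flat2_perm3: "rank (flat2 (perm3 A)) \<le> rank (flat1 A)"
  and rank_flat3_perm3: "rank (flat3 (perm3 A)) \<le> rank (flat2 A)"
  by (rule rank_le_of_column_map[where f = prod.swap],
      simp add: perm2_def perm3_def flat1_def flat2_def flat3_def)+

lemma tensor_inner_perm2: "tensor_inner (perm2 A) (outer3 y x z) = tensor_inner A (outer3 x y z)"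
  unfolding tensor_inner_def perm2_def outer3_def
  by (simp add: mult_ac) (rule sum.swap)

lemma tensor_inner_perm3: "tensor_inner (perm3 A) (outer3 z x y) = tensor_inner A (outer3 x y z)"
proof -
  define f where "f i j k = A $ i $ j $ k * conjugate (x $ i * y $ j * z $ k)" for i j k
  have "tensor_inner (perm3 A) (outer3 z x y) = (\<Sum>k\<in>UNIV. \<Sum>i\<in>UNIV. \<Sum>j\<in>UNIV. f i j k)"
    by (simp add: tensor_inner_def perm3_def outer3_def f_def mult_ac)
  also have "\<dots> = (\<Sum>i\<in>UNIV. \<Sum>k\<in>UNIV. \<Sum>j\<in>UNIV. f i j k)"
    by (rule sum.swap)
  also have "\<dots> = (\<Sum>i\<in>UNIV. \<Sum>j\<in>UNIV. \<Sum>k\<in>UNIV. f i j k)"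
    by (intro sum.cong refl sum.swap)
  finally show ?thesis
    by (simp add: tensor_inner_def outer3_def f_def)
qed

lemma tensor_spectral_norm_perm2: "tensor_spectral_norm (perm2 A) = tensor_spectral_norm A"
proof (rule antisym; rule tensor_spectral_norm_leI)
  fix x y z
  show "norm (tensor_inner (perm2 A) (outer3 y x z))
      \<le> tensor_spectral_norm A * (norm y * norm x * norm z)"
    using norm_tensor_inner_le_spectral_norm[of A x y z] by (simp add: tensor_inner_perm2 mult_ac)
  show "norm (tensor_inner A (outer3 x y z))
      \<le> tensor_spectral_norm (perm2 A) * (norm x * norm y * norm z)"
    using norm_tensor_inner_le_spectral_norm[of "perm2 A" y x z]
    by (simp add: tensor_inner_perm2 mult_ac)
qed

lemma tensor_spectral_norm_perm3: "tensor_spectral_norm (perm3 A) = tensor_spectral_norm A"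
proof (rule antisym; rule tensor_spectral_norm_leI)
  fix x y z
  show "norm (tensor_inner (perm3 A) (outer3 z x y))
      \<le> tensor_spectral_norm A * (norm z * norm x * norm y)"
    using norm_tensor_inner_le_spectral_norm[of A x y z] by (simp add: tensor_inner_perm3 mult_ac)
  show "norm (tensor_inner A (outer3 x y z))
      \<le> tensor_spectral_norm (perm3 A) * (norm x * norm y * norm z)"
    using norm_tensor_inner_le_spectral_norm[of "perm3 A" z x y]
    by (simp add: tensor_inner_perm3 mult_ac)
qed

lemma perm2_decomposition_iff:
  fixes A :: "'a::real_or_complex^'p^'n^'m"
  shows "perm2 A = (\<Sum>i\<in>I. outer3 (y i) (x i) (z i)) \<longleftrightarrow> A = (\<Sum>i\<in>I. outer3 (x i) (y i) (z i))"
  by (auto simp: vec_eq_iff perm2_def outer3_def mult_ac)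

lemma perm3_decomposition_iff:
  fixes A :: "'a::real_or_complex^'p^'n^'m"
  shows "perm3 A = (\<Sum>i\<in>I. outer3 (z i) (x i) (y i)) \<longleftrightarrow> A = (\<Sum>i\<in>I. outer3 (x i) (y i) (z i))"
  by (auto simp: vec_eq_iff perm3_def outer3_def mult_ac)

lemma tensor_nuclear_norm_perm2: "tensor_nuclear_norm (perm2 A) = tensor_nuclear_norm A"
proof (rule antisym; rule le_tensor_nuclear_norm)
  fix r :: nat and x y z
  assume "A = (\<Sum>i<r. outer3 (x i) (y i) (z i))"
  then show "tensor_nuclear_norm (perm2 A) \<le> (\<Sum>i<r. norm (x i) * norm (y i) * norm (z i))"
    using tensor_nuclear_norm_le[of "{..<r}" "perm2 A" y x z]
    by (simp add: perm2_decomposition_iff mult_ac)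
next
  fix r :: nat and x y z
  assume "perm2 A = (\<Sum>i<r. outer3 (x i) (y i) (z i))"
  then show "tensor_nuclear_norm A \<le> (\<Sum>i<r. norm (x i) * norm (y i) * norm (z i))"
    using tensor_nuclear_norm_le[of "{..<r}" A y x z]
    by (simp add: perm2_decomposition_iff mult_ac)
qed

lemma tensor_nuclear_norm_perm3: "tensor_nuclear_norm (perm3 A) = tensor_nuclear_norm A"
proof (rule antisym; rule le_tensor_nuclear_norm)
  fix r :: nat and x y z
  assume "A = (\<Sum>i<r. outer3 (x i) (y i) (z i))"
  then show "tensor_nuclear_norm (perm3 A) \<le> (\<Sum>i<r. norm (x i) * norm (y i) * norm (z i))"
    using tensor_nuclear_norm_le[of "{..<r}" "perm3 A" z x y]
    by (simp add: perm3_decomposition_iff mult_ac)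
next
  fix r :: nat and x y z
  assume "perm3 A = (\<Sum>i<r. outer3 (x i) (y i) (z i))"
  \<comment> \<open>In a decomposition of \<open>perm3 A\<close> the first factor belongs to mode 3,
    hence the order \<open>y z x\<close> for \<open>A\<close>.\<close>
  then show "tensor_nuclear_norm A \<le> (\<Sum>i<r. norm (x i) * norm (y i) * norm (z i))"
    using tensor_nuclear_norm_le[of "{..<r}" A y z x]
    by (simp add: perm3_decomposition_iff mult_ac)
qed

section \<open>Bounds for all three flattenings\<close>

lemma matrix_nuclear_norm_nonneg:
  fixes M :: "'a::real_or_complex^'n^'m"
  shows "0 \<le> matrix_nuclear_norm M"
proof -
  obtain v where "singular_basis M v" by (rule singular_basis_exists)
  then show ?thesis by (simp add: matrix_nuclear_norm_eq sum_nonneg)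
qed

lemma flattening_bounds:
  assumes "rank (flat2 A) \<le> r" "rank (flat3 A) \<le> r'"
  shows "matrix_spectral_norm (flat1 A) / sqrt (real (min r r')) \<le> tensor_spectral_norm A"
    and "tensor_nuclear_norm A \<le> sqrt (real (min r r')) * matrix_nuclear_norm (flat1 A)"
proof -
  have le: "sqrt (real (min (rank (flat2 A)) (rank (flat3 A)))) \<le> sqrt (real (min r r'))"
    using assms by (intro real_sqrt_le_mono of_nat_mono min.mono)
  have "matrix_spectral_norm (flat1 A) \<le> sqrt (real (min r r')) * tensor_spectral_norm A"
    using mult_right_mono[OF le tensor_spectral_norm_nonneg[of A]] flat1_spectral_norm_le[of A]
    by linarith
  \<comment> \<open>If the root is zero, division by zero makes the quotient zero, and nonnegativity
    of the tensor norm suffices.\<close>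
  then show "matrix_spectral_norm (flat1 A) / sqrt (real (min r r')) \<le> tensor_spectral_norm A"
    using tensor_spectral_norm_nonneg[of A]
    by (cases "sqrt (real (min r r')) = 0") (simp_all add: divide_simps mult.commute del: real_sqrt_eq_0_iff)
  show "tensor_nuclear_norm A \<le> sqrt (real (min r r')) * matrix_nuclear_norm (flat1 A)"
    using mult_right_mono[OF le matrix_nuclear_norm_nonneg[of "flat1 A"]]
      tensor_nuclear_norm_le_flat1[of A] by linarith
qed

theorem theorem9p4:
  fixes A :: "'a::real_or_complex^'p^'n^'m" and r1 r2 r3 :: nat
  assumes "multilinear_rank A = (r1, r2, r3)"
  shows
    "Max {matrix_spectral_norm (flat1 A) / sqrt (real (min r2 r3)),
          matrix_spectral_norm (flat2 A) / sqrt (real (min r1 r3)),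
          matrix_spectral_norm (flat3 A) / sqrt (real (min r1 r2))}
       \<le> tensor_spectral_norm A
     \<and> tensor_spectral_norm A
       \<le> Min {matrix_spectral_norm (flat1 A),
               matrix_spectral_norm (flat2 A),
               matrix_spectral_norm (flat3 A)}
     \<and> Max {matrix_nuclear_norm (flat1 A),
            matrix_nuclear_norm (flat2 A),
            matrix_nuclear_norm (flat3 A)}
       \<le> tensor_nuclear_norm A
     \<and> tensor_nuclear_norm A
       \<le> Min {sqrt (real (min r2 r3)) * matrix_nuclear_norm (flat1 A),
               sqrt (real (min r1 r3)) * matrix_nuclear_norm (flat2 A),
               sqrt (real (min r1 r2)) * matrix_nuclear_norm (flat3 A)}"
proof -
  have r: "rank (flat1 A) = r1" "rank (flat2 A) = r2" "rank (flat3 A) = r3"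
    using assms by (simp_all add: multilinear_rank_def)
  \<comment> \<open>The last two flattenings have ranks at most \<open>r1\<close> and
    \<open>r3\<close> for \<open>perm2 A\<close>, and at most \<open>r1\<close> and
    \<open>r2\<close> for \<open>perm3 A\<close>.\<close>
  note b1 = flattening_bounds[of A r2 r3]
  note b2 = flattening_bounds[of "perm2 A" r1 r3, unfolded flat1_perm2 flat2_perm2
      tensor_spectral_norm_perm2 tensor_nuclear_norm_perm2]
  note b3 = flattening_bounds[of "perm3 A" r1 r2, unfolded flat1_perm3
      tensor_spectral_norm_perm3 tensor_nuclear_norm_perm3]
  show ?thesis
    using b1 b2 b3 r rank_flat3_perm2[of A] rank_flat2_perm3[of A] rank_flat3_perm3[of A]
      tensor_spectral_norm_le_flat1[of A] flat1_nuclear_norm_le[of A]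
      tensor_spectral_norm_le_flat1[of "perm2 A"] flat1_nuclear_norm_le[of "perm2 A"]
      tensor_spectral_norm_le_flat1[of "perm3 A"] flat1_nuclear_norm_le[of "perm3 A"]
    by (simp add: flat1_perm2 flat1_perm3 tensor_spectral_norm_perm2 tensor_nuclear_norm_perm2
        tensor_spectral_norm_perm3 tensor_nuclear_norm_perm3)
qed

end
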